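(* The abstract commensurator $\mathrm{Com}(F)$ of Thompson's group $F$ is not finitely generated.
   Context: Thompson's group $F$ is the group, under composition, of all order-preserving homeomorphisms $f\colon\mathbb{R}\to\mathbb{R}$ that are piecewise linear with a discrete set of breakpoints (finitely many in every bounded interval), all breakpoints in $\mathbb{Z}[\frac12]$, all slopes integral powers of $2$, $f(\mathbb{Z}[\frac12])\subset\mathbb{Z}[\frac12]$, and for which there exist integers $l,r$ and a real $M>0$ with $f(t)=t+r$ for all $t>M$ and $f(t)=t+l$ for all $t<-M$. A commensuration of a group $G$ is an isomorphism $\alpha\colon A\to B$ between subgroups $A,B$ of finite index in $G$. Two commensurations are equivalent if they agree on some subgroup of finite index in $G$. The product $\beta\circ\alpha$ of $\alpha\colon A\to B$ and $\beta\colon C\to D$ is defined on $\alpha^{-1}(B\cap C)$. The equivalence classes with this product form the group $\mathrm{Com}(G)$, the (abstract) commensurator of $G$. *)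

theory Defs
  imports "HOL-Analysis.Analysis" "HOL-Algebra.Generated_Groups"
begin

section \<open>Thompson's group F\<close>

definition dyadic_rationals :: "real set" where
  "dyadic_rationals = {of_int m / 2 ^ n | (m::int) (n::nat). True}"

text \<open>A breakpoint is a point near which the function is not affine.  Hence a continuous function
  is piecewise linear with a discrete set of breakpoints iff its breakpoints, in this sense, are
  finite in number in every bounded interval.\<close>

definition breakpoints :: "(real \<Rightarrow> real) \<Rightarrow> real set" where
  "breakpoints f = {x. \<not> (\<exists>a b. \<forall>\<^sub>F t in nhds x. f t = a * t + b)}"

definition thompson_F_maps :: "(real \<Rightarrow> real) set" where
  "thompson_F_maps = {f.
     (\<exists>g. homeomorphism UNIV UNIV f g) \<and> mono f \<and>
     (\<forall>a b. finite (breakpoints f \<inter> {a..b})) \<and>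
     breakpoints f \<subseteq> dyadic_rationals \<and>
     (\<forall>t. t \<notin> breakpoints f \<longrightarrow> (\<exists>k::int. (f has_real_derivative 2 powi k) (at t))) \<and>
     f ` dyadic_rationals \<subseteq> dyadic_rationals \<and>
     (\<exists>(l::int) (r::int) (M::real). M > 0 \<and>
        (\<forall>t. t > M \<longrightarrow> f t = t + of_int r) \<and> (\<forall>t. t < - M \<longrightarrow> f t = t + of_int l))}"

definition thompson_F :: "(real \<Rightarrow> real) monoid" where
  "thompson_F = \<lparr>carrier = thompson_F_maps, mult = (\<lambda>f g. f \<circ> g), one = id\<rparr>"


section \<open>The abstract commensurator of a group\<close>

definition finite_index_subgroup :: "'a set \<Rightarrow> ('a, 'b) monoid_scheme \<Rightarrow> bool" where
  "finite_index_subgroup H G \<longleftrightarrow> subgroup H G \<and> finite (rcosets\<^bsub>G\<^esub> H)"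

text \<open>A commensuration is recorded as its domain, its codomain and its map; the map is required to
  be extensional, so that it is determined by its values on the domain.\<close>

type_synonym 'a partial_map = "'a set \<times> 'a set \<times> ('a \<Rightarrow> 'a)"

definition commensurations :: "('a, 'b) monoid_scheme \<Rightarrow> 'a partial_map set" where
  "commensurations G = {(A, B, \<alpha>).
     finite_index_subgroup A G \<and> finite_index_subgroup B G \<and>
     \<alpha> \<in> iso (G\<lparr>carrier := A\<rparr>) (G\<lparr>carrier := B\<rparr>) \<and> \<alpha> \<in> extensional A}"

definition commens_rel :: "('a, 'b) monoid_scheme \<Rightarrow> ('a partial_map \<times> 'a partial_map) set" where
  "commens_rel G = {((A, B, \<alpha>), (C, D, \<beta>)).
     (A, B, \<alpha>) \<in> commensurations G \<and> (C, D, \<beta>) \<in> commensurations G \<and>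
     (\<exists>K. finite_index_subgroup K G \<and> K \<subseteq> A \<inter> C \<and> (\<forall>x\<in>K. \<alpha> x = \<beta> x))}"

text \<open>\<open>commens_comp (C, D, \<beta>) (A, B, \<alpha>)\<close> is \<open>\<beta> \<circ> \<alpha>\<close>, defined on \<open>\<alpha>\<^sup>-\<^sup>1(B \<inter> C)\<close>.\<close>

fun commens_comp :: "'a partial_map \<Rightarrow> 'a partial_map \<Rightarrow> 'a partial_map" where
  "commens_comp (C, D, \<beta>) (A, B, \<alpha>) =
     (let E = {x \<in> A. \<alpha> x \<in> B \<inter> C} in (E, \<beta> ` (B \<inter> C), restrict (\<beta> \<circ> \<alpha>) E))"

text \<open>The union in \<open>mult\<close> is over equal classes, because \<open>commens_comp\<close> respects
  \<open>commens_rel\<close> (see \<open>commens_comp_cong\<close> and \<open>commens_mult\<close> below).\<close>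

definition commensurator :: "('a, 'b) monoid_scheme \<Rightarrow> 'a partial_map set monoid" where
  "commensurator G = \<lparr>
     carrier = commensurations G // commens_rel G,
     mult = (\<lambda>X Y. \<Union>x\<in>X. \<Union>y\<in>Y. commens_rel G `` {commens_comp x y}),
     one = commens_rel G `` {(carrier G, carrier G, \<lambda>x\<in>carrier G. x)}\<rparr>"


text \<open>The remainder of this section checks that the above is well defined and yields a group.\<close>

context group begin

lemma finite_index_iff_cover:
  assumes "subgroup H G"
  shows "finite (rcosets H) \<longleftrightarrow> (\<exists>T. finite T \<and> T \<subseteq> carrier G \<and> carrier G \<subseteq> (\<Union>t\<in>T. H #> t))"
proof
  assume fin: "finite (rcosets H)"
  have "rcosets H = (\<lambda>a. H #> a) ` carrier G" by (auto simp: RCOSETS_def)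
  then obtain T where T: "T \<subseteq> carrier G" "finite T" "rcosets H = (\<lambda>a. H #> a) ` T"
    using fin by (metis finite_subset_image subset_refl)
  moreover have "carrier G = \<Union>(rcosets H)" using assms rcosets_part_G by simp
  ultimately show "\<exists>T. finite T \<and> T \<subseteq> carrier G \<and> carrier G \<subseteq> (\<Union>t\<in>T. H #> t)" by auto
next
  assume "\<exists>T. finite T \<and> T \<subseteq> carrier G \<and> carrier G \<subseteq> (\<Union>t\<in>T. H #> t)"
  then obtain T where T: "finite T" "T \<subseteq> carrier G" "carrier G \<subseteq> (\<Union>t\<in>T. H #> t)" by auto
  have "rcosets H \<subseteq> (\<lambda>t. H #> t) ` T"
  proof
    fix R assume "R \<in> rcosets H"
    then obtain a where a: "a \<in> carrier G" "R = H #> a" by (auto simp: RCOSETS_def)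
    then obtain t where t: "t \<in> T" "a \<in> H #> t" using T by auto
    then have "H #> t = H #> a" using repr_independence assms T by blast
    then show "R \<in> (\<lambda>t. H #> t) ` T" using a t by auto
  qed
  then show "finite (rcosets H)" using T(1) finite_surj by blast
qed

lemma fi_subgroup: "finite_index_subgroup H G \<Longrightarrow> subgroup H G"
  by (simp add: finite_index_subgroup_def)

lemma fi_carrier: "finite_index_subgroup (carrier G) G"
proof -
  have "carrier G \<subseteq> (\<Union>t\<in>{\<one>}. carrier G #> t)" by (simp add: coset_mult_one)
  then show ?thesis unfolding finite_index_subgroup_def
    using subgroup_self finite_index_iff_cover[OF subgroup_self] by (metis finite.emptyI finite_insert empty_subsetI insert_subset one_closed)
qed

lemma fi_Int:
  assumes H: "finite_index_subgroup H G" and K: "finite_index_subgroup K G"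
  shows "finite_index_subgroup (H \<inter> K) G"
proof -
  have sH: "subgroup H G" and sK: "subgroup K G" using assms by (auto simp: finite_index_subgroup_def)
  then have s: "subgroup (H \<inter> K) G" by (rule subgroups_Inter_pair)
  have "rcosets (H \<inter> K) \<subseteq> (\<lambda>(X, Y). X \<inter> Y) ` ((rcosets H) \<times> (rcosets K))"
  proof
    fix R assume "R \<in> rcosets (H \<inter> K)"
    then obtain a where a: "a \<in> carrier G" "R = (H \<inter> K) #> a" by (auto simp: RCOSETS_def)
    have "(H \<inter> K) #> a = (H #> a) \<inter> (K #> a)"
    proof
      show "(H \<inter> K) #> a \<subseteq> (H #> a) \<inter> (K #> a)" by (auto simp: r_coset_def)
      show "(H #> a) \<inter> (K #> a) \<subseteq> (H \<inter> K) #> a"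
      proof
        fix z assume "z \<in> (H #> a) \<inter> (K #> a)"
        then obtain h k where hk: "h \<in> H" "k \<in> K" "z = h \<otimes> a" "z = k \<otimes> a" by (auto simp: r_coset_def)
        then have "h = k" using a subgroup.mem_carrier[OF sH] subgroup.mem_carrier[OF sK] right_cancel[of a h k] by simp
        then show "z \<in> (H \<inter> K) #> a" using hk by (auto simp: r_coset_def)
      qed
    qed
    then show "R \<in> (\<lambda>(X, Y). X \<inter> Y) ` ((rcosets H) \<times> (rcosets K))"
      using a by (auto simp: RCOSETS_def)
  qed
  moreover have "finite ((rcosets H) \<times> (rcosets K))" using assms by (simp add: finite_index_subgroup_def)
  ultimately show ?thesis using s unfolding finite_index_subgroup_def by (meson finite_surj)
qed

lemma fi_image:
  assumes A: "finite_index_subgroup A G" and B: "finite_index_subgroup B G"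
    and f: "\<alpha> \<in> iso (G\<lparr>carrier := A\<rparr>) (G\<lparr>carrier := B\<rparr>)"
    and K: "finite_index_subgroup K G" "K \<subseteq> A"
  shows "finite_index_subgroup (\<alpha> ` K) G"
proof -
  have sA: "subgroup A G" and sB: "subgroup B G" and sK: "subgroup K G"
    using assms by (auto simp: finite_index_subgroup_def)
  have gA: "group (G\<lparr>carrier := A\<rparr>)" and gB: "group (G\<lparr>carrier := B\<rparr>)"
    using sA sB subgroup_imp_group by auto
  have KA: "subgroup K (G\<lparr>carrier := A\<rparr>)" using subgroup_incl[OF sK sA K(2)] .
  have hom: "\<alpha> (x \<otimes> y) = \<alpha> x \<otimes> \<alpha> y" if "x \<in> A" "y \<in> A" for x y
    using f that by (auto simp: iso_def hom_def)
  have img: "\<alpha> ` A = B" using f by (auto simp: iso_def bij_betw_def)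
  have "group_hom (G\<lparr>carrier := A\<rparr>) (G\<lparr>carrier := B\<rparr>) \<alpha>"
    using gA gB f by (simp add: group_hom_def group_hom_axioms_def iso_def)
  then have "subgroup (\<alpha> ` K) (G\<lparr>carrier := B\<rparr>)"
    using KA group_hom.subgroup_img_is_subgroup by blast
  then have s: "subgroup (\<alpha> ` K) G" using sB incl_subgroup by blast
  obtain T where T: "finite T" "T \<subseteq> carrier G" "carrier G \<subseteq> (\<Union>t\<in>T. K #> t)"
    using K finite_index_iff_cover[OF sK] by (auto simp: finite_index_subgroup_def)
  obtain S where S: "finite S" "S \<subseteq> carrier G" "carrier G \<subseteq> (\<Union>t\<in>S. B #> t)"
    using B finite_index_iff_cover[OF sB] by (auto simp: finite_index_subgroup_def)
  have TA: "a \<in> (\<Union>t\<in>T \<inter> A. K #> t)" if a: "a \<in> A" for a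
  proof -
    have ac: "a \<in> carrier G" using a sA subgroup.mem_carrier by fast
    obtain t k where tk: "t \<in> T" "k \<in> K" "a = k \<otimes> t" using T(3) ac by (force simp: r_coset_def)
    have kc: "k \<in> carrier G" "t \<in> carrier G" using tk(1,2) T(2) subgroup.mem_carrier[OF sK] by auto
    have "t = inv k \<otimes> a" using tk kc by (simp add: m_assoc[symmetric])
    moreover have "inv k \<in> A" using sA tk K(2) by (meson subgroup.m_inv_closed subsetD)
    ultimately have "t \<in> A" using a sA by (simp add: subgroup.m_closed)
    then show ?thesis using tk by (auto simp: r_coset_def)
  qed
  let ?U = "(\<lambda>(t, s). \<alpha> t \<otimes> s) ` ((T \<inter> A) \<times> S)"
  have "finite ?U" using T S by simp
  moreover have aB: "\<And>t. t \<in> A \<Longrightarrow> \<alpha> t \<in> carrier G"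
    using img subgroup.mem_carrier[OF sB] by auto
  then have "?U \<subseteq> carrier G" using S(2) by auto
  moreover have "carrier G \<subseteq> (\<Union>u\<in>?U. \<alpha> ` K #> u)"
  proof
    fix g assume "g \<in> carrier G"
    then obtain s b where sb: "s \<in> S" "b \<in> B" "g = b \<otimes> s" using S(3) by (force simp: r_coset_def)
    obtain a where a: "a \<in> A" "b = \<alpha> a" using sb img by auto
    obtain t k where tk: "t \<in> T \<inter> A" "k \<in> K" "a = k \<otimes> t" using TA[OF a(1)] by (force simp: r_coset_def)
    have "k \<in> A" "t \<in> A" "s \<in> carrier G" using tk K(2) S(2) sb(1) by auto
    then have "g = \<alpha> k \<otimes> (\<alpha> t \<otimes> s)" using sb(3) a(2) tk(3) by (simp add: hom aB m_assoc)
    then show "g \<in> (\<Union>u\<in>?U. \<alpha> ` K #> u)" using tk sb by (force simp: r_coset_def)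
  qed
  ultimately have "finite (rcosets (\<alpha> ` K))" using finite_index_iff_cover[OF s] by blast
  then show ?thesis using s by (simp add: finite_index_subgroup_def)
qed

lemma commens_inv:
  assumes "(A, B, \<alpha>) \<in> commensurations G"
  shows "(B, A, restrict (inv_into A \<alpha>) B) \<in> commensurations G"
proof -
  have f: "\<alpha> \<in> iso (G\<lparr>carrier := A\<rparr>) (G\<lparr>carrier := B\<rparr>)"
    and A: "finite_index_subgroup A G" and B: "finite_index_subgroup B G"
    using assms by (auto simp: commensurations_def)
  have gA: "group (G\<lparr>carrier := A\<rparr>)" and gB: "group (G\<lparr>carrier := B\<rparr>)"
    using A B subgroup_imp_group by (auto simp: finite_index_subgroup_def)
  have "inv_into A \<alpha> \<in> iso (G\<lparr>carrier := B\<rparr>) (G\<lparr>carrier := A\<rparr>)"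
    using group.iso_set_sym[OF gA f] by simp
  then have "restrict (inv_into A \<alpha>) B \<in> iso (G\<lparr>carrier := B\<rparr>) (G\<lparr>carrier := A\<rparr>)"
    using group.iso_eq[OF gB] by fastforce
  then show ?thesis using A B by (auto simp: commensurations_def)
qed

lemma fi_vimage:
  assumes "(A, B, \<alpha>) \<in> commensurations G" and K: "finite_index_subgroup K G" 
  shows "finite_index_subgroup {x\<in>A. \<alpha> x \<in> K} G"
proof -
  have bij: "bij_betw \<alpha> A B" and B: "finite_index_subgroup B G" 
    using assms by (auto simp: commensurations_def iso_def)
  have "{x\<in>A. \<alpha> x \<in> K} = restrict (inv_into A \<alpha>) B ` (B \<inter> K)"
  proof (intro equalityI subsetI)
    fix x assume x: "x \<in> {x\<in>A. \<alpha> x \<in> K}"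
    then have "\<alpha> x \<in> B \<inter> K" using bij by (auto simp: bij_betw_def)
    moreover have "inv_into A \<alpha> (\<alpha> x) = x" using bij x by (auto simp: bij_betw_def)
    ultimately show "x \<in> restrict (inv_into A \<alpha>) B ` (B \<inter> K)" by (metis IntD1 image_eqI restrict_apply')
  next
    fix x assume "x \<in> restrict (inv_into A \<alpha>) B ` (B \<inter> K)"
    then obtain b where b: "b \<in> B" "b \<in> K" "x = inv_into A \<alpha> b" by auto
    moreover have "b \<in> \<alpha> ` A" using b bij by (auto simp: bij_betw_def)
    ultimately show "x \<in> {x\<in>A. \<alpha> x \<in> K}" by (auto simp: inv_into_into f_inv_into_f)
  qed
  moreover have "finite_index_subgroup (restrict (inv_into A \<alpha>) B ` (B \<inter> K)) G"
  proof (rule fi_image)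
    show "finite_index_subgroup B G" by (rule B)
    show "finite_index_subgroup A G" "restrict (inv_into A \<alpha>) B \<in> iso (G\<lparr>carrier := B\<rparr>) (G\<lparr>carrier := A\<rparr>)"
      using commens_inv[OF assms(1)] by (auto simp: commensurations_def)
  qed (use fi_Int[OF B K] in auto)
  ultimately show ?thesis by simp
qed

lemma commens_comp_closed:
  assumes y: "(C, D, \<beta>) \<in> commensurations G" and x: "(A, B, \<alpha>) \<in> commensurations G"
  shows "commens_comp (C, D, \<beta>) (A, B, \<alpha>) \<in> commensurations G"
proof -
  let ?E = "{x \<in> A. \<alpha> x \<in> B \<inter> C}"
  have C: "finite_index_subgroup C G" "finite_index_subgroup D G" "finite_index_subgroup B G"
    and b: "\<beta> \<in> iso (G\<lparr>carrier := C\<rparr>) (G\<lparr>carrier := D\<rparr>)" and a: "\<alpha> \<in> iso (G\<lparr>carrier := A\<rparr>) (G\<lparr>carrier := B\<rparr>)"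
    using x y by (auto simp: commensurations_def)
  have BC: "finite_index_subgroup (B \<inter> C) G" using C fi_Int by blast
  have E: "finite_index_subgroup ?E G" using fi_vimage[OF x BC] .
  have F: "finite_index_subgroup (\<beta> ` (B \<inter> C)) G" using fi_image[OF C(1,2) b BC] by blast
  have aE: "\<alpha> ` ?E = B \<inter> C" using a by (auto simp: iso_def bij_betw_def)
  have h: "restrict (\<beta> \<circ> \<alpha>) ?E \<in> hom (G\<lparr>carrier := ?E\<rparr>) (G\<lparr>carrier := \<beta> ` (B \<inter> C)\<rparr>)"
  proof (rule homI)
    fix p assume "p \<in> carrier (G\<lparr>carrier := ?E\<rparr>)"
    then show "restrict (\<beta> \<circ> \<alpha>) ?E p \<in> carrier (G\<lparr>carrier := \<beta> ` (B \<inter> C)\<rparr>)" by auto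
  next
    fix p q assume p: "p \<in> carrier (G\<lparr>carrier := ?E\<rparr>)" and q: "q \<in> carrier (G\<lparr>carrier := ?E\<rparr>)"
    have "p \<otimes> q \<in> ?E" using p q subgroup.m_closed[OF fi_subgroup[OF E]] by simp
    moreover have "\<alpha> (p \<otimes> q) = \<alpha> p \<otimes> \<alpha> q" using p q a by (simp add: iso_def hom_def)
    moreover have "\<beta> (\<alpha> p \<otimes> \<alpha> q) = \<beta> (\<alpha> p) \<otimes> \<beta> (\<alpha> q)" using p q b by (simp add: iso_def hom_def)
    ultimately show "restrict (\<beta> \<circ> \<alpha>) ?E (p \<otimes>\<^bsub>G\<lparr>carrier := ?E\<rparr>\<^esub> q) =
       restrict (\<beta> \<circ> \<alpha>) ?E p \<otimes>\<^bsub>G\<lparr>carrier := \<beta> ` (B \<inter> C)\<rparr>\<^esub> restrict (\<beta> \<circ> \<alpha>) ?E q"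
      using p q by simp
  qed
  have "inj_on \<alpha> ?E" "inj_on \<beta> (B \<inter> C)" using a b by (auto simp: iso_def bij_betw_def inj_on_def)
  then have "inj_on (\<beta> \<circ> \<alpha>) ?E" using aE comp_inj_on by metis
  moreover have "(\<beta> \<circ> \<alpha>) ` ?E = \<beta> ` (B \<inter> C)" by (simp only: image_comp[symmetric] aE)
  ultimately have "bij_betw (\<beta> \<circ> \<alpha>) ?E (\<beta> ` (B \<inter> C))" unfolding bij_betw_def by blast
  then have "bij_betw (restrict (\<beta> \<circ> \<alpha>) ?E) ?E (\<beta> ` (B \<inter> C))"
    by (subst bij_betw_restrict_eq)
  then show ?thesis using h E F by (simp add: commensurations_def iso_def Let_def)
qed

lemma comm_equiv: "equiv (commensurations G) (commens_rel G)"
proof (rule equivI)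
  show "commens_rel G \<subseteq> commensurations G \<times> commensurations G" by (auto simp: commens_rel_def)
  show "refl_on (commensurations G) (commens_rel G)"
    by (auto simp: refl_on_def commens_rel_def) (auto simp: commensurations_def)
  show "sym (commens_rel G)" unfolding sym_def commens_rel_def 
    by (auto simp: Int_commute)
  show "trans (commens_rel G)"
  proof (rule transI)
    fix x y z assume xy: "(x, y) \<in> commens_rel G" and yz: "(y, z) \<in> commens_rel G"
    obtain A B a C D b E F c where e: "x = (A, B, a)" "y = (C, D, b)" "z = (E, F, c)"
      by (metis prod_cases3)
    obtain K L where "finite_index_subgroup K G" "K \<subseteq> A \<inter> C" "\<forall>x\<in>K. a x = b x"
      "finite_index_subgroup L G" "L \<subseteq> C \<inter> E" "\<forall>x\<in>L. b x = c x"
      using xy yz e by (auto simp: commens_rel_def)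
    then have "finite_index_subgroup (K \<inter> L) G \<and> K \<inter> L \<subseteq> A \<inter> E \<and> (\<forall>x\<in>K \<inter> L. a x = c x)"
      using fi_Int by auto
    then show "(x, z) \<in> commens_rel G" using xy yz e by (auto simp: commens_rel_def)
  qed
qed

lemma commens_comp_cong:
  assumes "(x, x') \<in> commens_rel G" "(y, y') \<in> commens_rel G"
  shows "(commens_comp x y, commens_comp x' y') \<in> commens_rel G"
proof -
  obtain A B a A' B' a' C D b C' D' b' where e: "x = (C, D, b)" "x' = (C', D', b')" "y = (A, B, a)" "y' = (A', B', a')"
    by (metis prod_cases3)
  obtain K L where K: "finite_index_subgroup K G" "K \<subseteq> A \<inter> A'" "\<forall>x\<in>K. a x = a' x"
      and L: "finite_index_subgroup L G" "L \<subseteq> C \<inter> C'" "\<forall>x\<in>L. b x = b' x"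
    using assms e by (auto simp: commens_rel_def)
  have c: "x \<in> commensurations G" "x' \<in> commensurations G" "y \<in> commensurations G" "y' \<in> commensurations G"
    using assms by (auto simp: commens_rel_def)
  let ?M = "K \<inter> {x \<in> A. a x \<in> L}"
  have "finite_index_subgroup ?M G" using K(1) fi_vimage c e L(1) fi_Int by blast
  moreover have "?M \<subseteq> {x \<in> A. a x \<in> B \<inter> C} \<inter> {x \<in> A'. a' x \<in> B' \<inter> C'}"
    using K L c e by (auto simp: commensurations_def iso_def bij_betw_def)
  moreover have "\<forall>x\<in>?M. b (a x) = b' (a' x)" using K L by auto
  ultimately have "\<exists>M. finite_index_subgroup M G \<and> M \<subseteq> {x \<in> A. a x \<in> B \<inter> C} \<inter> {x \<in> A'. a' x \<in> B' \<inter> C'} \<and>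
     (\<forall>x\<in>M. restrict (b \<circ> a) {x \<in> A. a x \<in> B \<inter> C} x = restrict (b' \<circ> a') {x \<in> A'. a' x \<in> B' \<inter> C'} x)"
    by (intro exI[of _ ?M]) auto
  moreover have "commens_comp x y \<in> commensurations G" "commens_comp x' y' \<in> commensurations G"
    using commens_comp_closed c e by auto
  ultimately show ?thesis using e by (simp add: commens_rel_def Let_def)
qed

lemma commens_mult:
  assumes "x \<in> commensurations G" "y \<in> commensurations G"
  shows "(commens_rel G `` {x}) \<otimes>\<^bsub>commensurator G\<^esub> (commens_rel G `` {y}) = commens_rel G `` {commens_comp x y}"
proof -
  have "commens_rel G `` {commens_comp x' y'} = commens_rel G `` {commens_comp x y}"
    if "x' \<in> commens_rel G `` {x}" "y' \<in> commens_rel G `` {y}" for x' y'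
    using that commens_comp_cong[of x x' y y'] equiv_class_eq[OF comm_equiv] by fastforce
  moreover have "x \<in> commens_rel G `` {x}" "y \<in> commens_rel G `` {y}"
    using assms equiv_class_self[OF comm_equiv] by auto
  ultimately have "(\<Union>x'\<in>commens_rel G `` {x}. \<Union>y'\<in>commens_rel G `` {y}. commens_rel G `` {commens_comp x' y'})
     = commens_rel G `` {commens_comp x y}" by blast
  then show ?thesis by (simp add: commensurator_def)
qed

lemma relI:
  assumes "x \<in> commensurations G" "y \<in> commensurations G" "fst x \<subseteq> fst y" "\<And>t. t \<in> fst x \<Longrightarrow> snd (snd x) t = snd (snd y) t"
  shows "commens_rel G `` {x} = commens_rel G `` {y}"
proof -
  have "(x, y) \<in> commens_rel G" using assms
    by (cases x; cases y) (auto simp: commens_rel_def commensurations_def)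
  then show ?thesis using equiv_class_eq[OF comm_equiv] by blast
qed

theorem commensurator_group: "group (commensurator G)"
proof (rule groupI)
  let ?q = "\<lambda>x. commens_rel G `` {x}" and ?C = "commensurations G"
  let ?i = "(carrier G, carrier G, \<lambda>x\<in>carrier G. x)"
  have i: "?i \<in> ?C"
    using fi_carrier by (auto simp: commensurations_def iso_def hom_def bij_betw_def inj_on_def)
  have carr: "carrier (commensurator G) = ?C // commens_rel G" by (simp add: commensurator_def)
  have one: "\<one>\<^bsub>commensurator G\<^esub> = ?q ?i" by (simp add: commensurator_def)
  have cc: "commens_comp x y \<in> ?C" if "x \<in> ?C" "y \<in> ?C" for x y
    using that commens_comp_closed by (metis prod_cases3)
  show "\<one>\<^bsub>commensurator G\<^esub> \<in> carrier (commensurator G)" using i carr one by (simp add: quotientI)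
  fix X assume "X \<in> carrier (commensurator G)"
  then obtain x where x: "x \<in> ?C" "X = ?q x" using carr by (auto elim: quotientE)
  obtain A B a where xe: "x = (A, B, a)" by (metis prod_cases3)
  have AB: "A \<subseteq> carrier G" "B \<subseteq> carrier G" "bij_betw a A B" using x xe
    by (auto simp: commensurations_def iso_def dest!: fi_subgroup subgroup.subset)
  have "?q (commens_comp ?i x) = ?q x" 
    using cc[OF i x(1)] x(1) AB xe by (intro relI) (auto simp: Let_def)
  then show "\<one>\<^bsub>commensurator G\<^esub> \<otimes>\<^bsub>commensurator G\<^esub> X = X" using commens_mult[OF i x(1)] one x by simp
  let ?y = "(B, A, restrict (inv_into A a) B)"
  have y: "?y \<in> ?C" using commens_inv x xe by blast
  have "?q (commens_comp ?y x) = ?q ?i"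
    using cc[OF y x(1)] i AB xe by (intro relI) (auto simp: Let_def bij_betw_def)
  then have "?q ?y \<otimes>\<^bsub>commensurator G\<^esub> X = \<one>\<^bsub>commensurator G\<^esub>" using commens_mult[OF y x(1)] one x by simp
  then show "\<exists>Y\<in>carrier (commensurator G). Y \<otimes>\<^bsub>commensurator G\<^esub> X = \<one>\<^bsub>commensurator G\<^esub>"
    using y carr by (auto intro: quotientI)
  fix Y assume "Y \<in> carrier (commensurator G)"
  then obtain y where y: "y \<in> ?C" "Y = ?q y" using carr by (auto elim: quotientE)
  show "X \<otimes>\<^bsub>commensurator G\<^esub> Y \<in> carrier (commensurator G)" 
    using x y carr commens_mult[OF x(1) y(1)] cc by (simp add: quotientI)
  fix Z assume "Z \<in> carrier (commensurator G)"
  then obtain z where z: "z \<in> ?C" "Z = ?q z" using carr by (auto elim: quotientE)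
  obtain C D b E F c where ye: "y = (C, D, b)" "z = (E, F, c)" by (metis prod_cases3)
  have b: "bij_betw b C D" "bij_betw c E F" using y z ye by (auto simp: commensurations_def iso_def)
  have "?q (commens_comp (commens_comp x y) z) = ?q (commens_comp x (commens_comp y z))"
  proof (rule relI)
    show "commens_comp (commens_comp x y) z \<in> ?C" "commens_comp x (commens_comp y z) \<in> ?C" using cc x y z by auto
  qed (use b AB in \<open>auto simp: xe ye Let_def bij_betw_def split: if_splits\<close>)
  then show "X \<otimes>\<^bsub>commensurator G\<^esub> Y \<otimes>\<^bsub>commensurator G\<^esub> Z = X \<otimes>\<^bsub>commensurator G\<^esub> (Y \<otimes>\<^bsub>commensurator G\<^esub> Z)"
    using x y z cc commens_mult by simp
qed

end


section \<open>Finite generation\<close>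

definition finitely_generated_group :: "('a, 'b) monoid_scheme \<Rightarrow> bool" where
  "finitely_generated_group G \<longleftrightarrow> (\<exists>S. finite S \<and> S \<subseteq> carrier G \<and> generate G S = carrier G)"

end

theory Submission
  imports Defs "HOL-Computational_Algebra.Primes"
begin

text \<open>For every group \<open>G\<close>, sending a commensuration \<open>A \<rightarrow> B\<close> to \<open>[G : B] / [G : A]\<close> defines a
  homomorphism from \<open>Com(G)\<close> to the positive rationals: restricting to a subgroup of finite
  index multiplies both indices by the same number. If \<open>Com(G)\<close> is finitely generated, only finitely
  many primes divide the numerators and denominators of the values.  In Thompson's group, the elements
  that are translation by a multiple of \<open>n\<close> near \<open>\<infinity>\<close> form a subgroup of index \<open>n\<close>. A
  piecewise linear homeomorphism \<open>h\<close> with \<open>h (t + (p - 1)) = h t + p\<close> on the positive half-line and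
  \<open>h t = t\<close> on the negative one conjugates the subgroup for \<open>p - 1\<close> to that for \<open>p\<close>, so every
  prime \<open>p\<close> divides the numerator of some value.\<close>

section \<open>The index ratio of a commensuration\<close>

context group begin

text \<open>Fix a representative \<open>s R\<close> of every right coset \<open>R\<close> of
  \<open>A\<close>. Each coset of \<open>K\<close> is \<open>K #> a #> s R\<close> for a unique pair
  of a coset \<open>K #> a\<close> inside \<open>A\<close> and an \<open>R\<close>, which gives
  [G : K] = [A : K] [G : A].\<close>

lemma index_mult:
  assumes A: "subgroup A G" and K: "subgroup K G" "K \<subseteq> A"
  shows "card (rcosets K) = card ((#>) K ` A) * card (rcosets A)"
proof -
  have AG: "\<And>a. a \<in> A \<Longrightarrow> a \<in> carrier G" using subgroup.mem_carrier[OF A] .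
  have KG: "K \<subseteq> carrier G" using subgroup.subset[OF K(1)] .
  have "\<exists>g. g \<in> carrier G \<and> R = A #> g" if "R \<in> rcosets A" for R
    using that by (auto simp: RCOSETS_def)
  then obtain s where "\<And>R. R \<in> rcosets A \<Longrightarrow> s R \<in> carrier G \<and> R = A #> s R" by metis
  then have s: "s R \<in> carrier G" and R_eq: "R = A #> s R" if "R \<in> rcosets A" for R using that by auto
  have "bij_betw (\<lambda>(X, R). X #> s R) (((#>) K ` A) \<times> rcosets A) (rcosets K)"
  proof (rule bij_betw_imageI)
    show "inj_on (\<lambda>(X, R). X #> s R) (((#>) K ` A) \<times> rcosets A)"
    proof (rule inj_onI, clarify)
      fix a R b Q assume a: "a \<in> A" and b: "b \<in> A" and R: "R \<in> rcosets A" and Q: "Q \<in> rcosets A"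
        and eq: "K #> a #> s R = K #> b #> s Q"
      have sR: "s R \<in> carrier G" "s Q \<in> carrier G" using s R Q by auto
      have eq': "K #> (a \<otimes> s R) = K #> (b \<otimes> s Q)"
        using eq AG[OF a] AG[OF b] sR KG by (simp add: coset_mult_assoc)
      have "a \<otimes> s R \<in> K #> (a \<otimes> s R)"
        using AG[OF a] sR K(1) by (simp add: rcos_self)
      then obtain k where k: "k \<in> K" "a \<otimes> s R = k \<otimes> (b \<otimes> s Q)"
        using eq' by (auto simp: r_coset_def)
      have kG: "k \<in> carrier G" using k KG by auto
      have "s R = (inv a \<otimes> k \<otimes> b) \<otimes> s Q"
        using k kG AG[OF a] AG[OF b] sR by (simp add: m_assoc inv_solve_left)
      moreover have "inv a \<otimes> k \<otimes> b \<in> A"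
        using a b k K(2) A by (meson subgroup.m_closed subgroup.m_inv_closed subsetD)
      ultimately have "s R \<in> A #> s Q" by (auto simp: r_coset_def)
      then have "A #> s Q = A #> s R" using repr_independence A sR by blast
      then have RQ: "R = Q" using R_eq[OF R] R_eq[OF Q] by simp
      then have "K #> a #> s R #> inv (s R) = K #> b #> s R #> inv (s R)" using eq by simp
      then have "K #> a = K #> b"
        using AG[OF a] AG[OF b] sR KG by (simp add: coset_mult_assoc m_assoc)
      then show "K #> a = K #> b \<and> R = Q" using RQ by simp
    qed
    show "(\<lambda>(X, R). X #> s R) ` (((#>) K ` A) \<times> rcosets A) = rcosets K"
    proof (intro equalityI subsetI)
      fix X assume "X \<in> (\<lambda>(X, R). X #> s R) ` (((#>) K ` A) \<times> rcosets A)"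
      then obtain a R where aR: "a \<in> A" "R \<in> rcosets A" "X = K #> a #> s R" by auto
      then have "X = K #> (a \<otimes> s R)" using s AG KG by (simp add: coset_mult_assoc)
      moreover have "a \<otimes> s R \<in> carrier G" using aR s AG by simp
      ultimately show "X \<in> rcosets K" unfolding RCOSETS_def by blast
    next
      fix X assume "X \<in> rcosets K"
      then obtain g where g: "g \<in> carrier G" "X = K #> g" by (auto simp: RCOSETS_def)
      let ?R = "A #> g"
      have R: "?R \<in> rcosets A" using g by (auto simp: RCOSETS_def)
      then have sR: "s ?R \<in> carrier G" "?R = A #> s ?R" using s R_eq by blast+
      have "g \<in> ?R" using g A by (simp add: rcos_self)
      then have "g \<in> A #> s ?R" using sR(2) by simp
      then obtain a where a: "a \<in> A" "g = a \<otimes> s ?R" unfolding r_coset_def by blast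
      then have "X = K #> a #> s ?R" using g(2) coset_mult_assoc[OF KG AG[OF a(1)] sR(1)] by simp
      then show "X \<in> (\<lambda>(X, R). X #> s R) ` (((#>) K ` A) \<times> rcosets A)"
        using a(1) R by (intro image_eqI[of _ _ "(K #> a, ?R)"]) auto
    qed
  qed
  then show ?thesis by (metis bij_betw_same_card card_cartesian_product)
qed

text \<open>Taking images under \<open>\<alpha>\<close> sends the coset of \<open>K\<close> through
  \<open>a\<close> to the coset of the image of \<open>K\<close> through \<open>\<alpha> a\<close>,
  and by injectivity distinct subsets of \<open>A\<close> have distinct images.\<close>

lemma relative_index_iso:
  assumes A: "subgroup A G" and K: "K \<subseteq> A"
    and f: "\<alpha> \<in> iso (G\<lparr>carrier := A\<rparr>) (G\<lparr>carrier := B\<rparr>)"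
  shows "card ((#>) (\<alpha> ` K) ` B) = card ((#>) K ` A)"
proof -
  have hom: "\<alpha> (x \<otimes> y) = \<alpha> x \<otimes> \<alpha> y" if "x \<in> A" "y \<in> A" for x y
    using f that by (auto simp: iso_def hom_def)
  have bij: "inj_on \<alpha> A" "\<alpha> ` A = B" using f by (auto simp: iso_def bij_betw_def)
  have sub: "K #> a \<subseteq> A" if "a \<in> A" for a
    using that K subgroup.m_closed[OF A] by (auto simp: r_coset_def)
  have img: "\<alpha> ` (K #> a) = (\<alpha> ` K) #> \<alpha> a" if a: "a \<in> A" for a
  proof -
    have "\<alpha> (k \<otimes> a) = \<alpha> k \<otimes> \<alpha> a" if "k \<in> K" for k using hom a K that by auto
    then show ?thesis by (auto simp: r_coset_def image_UN)
  qed
  have "(#>) (\<alpha> ` K) ` B = image \<alpha> ` ((#>) K ` A)"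
    using bij(2) img by (force simp: image_image)
  moreover have "inj_on (image \<alpha>) ((#>) K ` A)"
    by (rule inj_on_subset[OF inj_on_image_Pow[OF bij(1)]]) (use sub in auto)
  ultimately show ?thesis by (simp add: card_image)
qed

section \<open>Multiplicativity of the index ratio\<close>

definition index_ratio :: "'a partial_map \<Rightarrow> real" where
  "index_ratio x = real (card (rcosets (fst (snd x)))) / real (card (rcosets (fst x)))"

lemma index_pos:
  assumes "finite_index_subgroup A G"
  shows "card (rcosets A) > 0"
proof -
  have "A #> \<one> \<in> rcosets A" by (auto simp: RCOSETS_def)
  then show ?thesis using assms by (auto simp: finite_index_subgroup_def card_gt_0_iff)
qed

text \<open>By the tower law both indices grow by the factor [A : K], which \<open>\<alpha>\<close>
  preserves. The domain may thus be shrunk, and the next two lemmas follow by choosing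
  \<open>K\<close> well.\<close>

lemma index_ratio_restrict:
  assumes x: "(A, B, \<alpha>) \<in> commensurations G" and K: "finite_index_subgroup K G" "K \<subseteq> A"
  shows "index_ratio (A, B, \<alpha>) = real (card (rcosets (\<alpha> ` K))) / real (card (rcosets K))"
proof -
  have A: "finite_index_subgroup A G" and B: "finite_index_subgroup B G"
    and f: "\<alpha> \<in> iso (G\<lparr>carrier := A\<rparr>) (G\<lparr>carrier := B\<rparr>)"
    using x by (auto simp: commensurations_def)
  have aK: "finite_index_subgroup (\<alpha> ` K) G" "\<alpha> ` K \<subseteq> B"
    using fi_image[OF A B f K] K f by (auto simp: iso_def bij_betw_def)
  have "card (rcosets K) = card ((#>) K ` A) * card (rcosets A)"
    using index_mult fi_subgroup A K by blast
  moreover have "card (rcosets (\<alpha> ` K)) = card ((#>) K ` A) * card (rcosets B)"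
    using index_mult[OF fi_subgroup[OF B] fi_subgroup[OF aK(1)] aK(2)]
      relative_index_iso[OF fi_subgroup[OF A] K(2) f] by simp
  ultimately show ?thesis using index_pos[OF K(1)] by (simp add: index_ratio_def)
qed

text \<open>Both maps agree on a common \<open>K\<close>, hence have the same image of it, and each
  ratio can be computed from that restriction. The ratio therefore descends to classes.\<close>

lemma index_ratio_cong:
  assumes "(x, y) \<in> commens_rel G"
  shows "index_ratio x = index_ratio y"
proof -
  obtain A B a C D b where e: "x = (A, B, a)" "y = (C, D, b)" by (metis prod_cases3)
  obtain K where K: "finite_index_subgroup K G" "K \<subseteq> A \<inter> C" "\<forall>x\<in>K. a x = b x"
    and xy: "x \<in> commensurations G" "y \<in> commensurations G"
    using assms e by (auto simp: commens_rel_def)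
  have "a ` K = b ` K" using K(3) by simp
  then show ?thesis using K xy e index_ratio_restrict[of A B a K] index_ratio_restrict[of C D b K] by simp
qed

text \<open>The restriction of \<open>y\<close> to the domain of the composition maps onto
  \<open>B \<inter> C\<close>, where the restriction of \<open>x\<close> starts; the index of this
  middle group cancels.\<close>

lemma index_ratio_comp:
  assumes x: "x \<in> commensurations G" and y: "y \<in> commensurations G"
  shows "index_ratio (commens_comp x y) = index_ratio x * index_ratio y"
proof -
  obtain A B a C D b where e: "x = (C, D, b)" "y = (A, B, a)" by (metis prod_cases3)
  let ?E = "{x \<in> A. a x \<in> B \<inter> C}"
  have BC: "finite_index_subgroup (B \<inter> C) G" and a: "bij_betw a A B"
    using x y e fi_Int by (auto simp: commensurations_def iso_def)
  have E: "finite_index_subgroup ?E G" using fi_vimage y BC e by blast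
  have "a ` ?E = B \<inter> C" using a by (auto simp: bij_betw_def)
  then have "index_ratio y = real (card (rcosets (B \<inter> C))) / real (card (rcosets ?E))"
    using index_ratio_restrict[of A B a ?E] y e E by auto
  moreover have "index_ratio x = real (card (rcosets (b ` (B \<inter> C)))) / real (card (rcosets (B \<inter> C)))"
    using index_ratio_restrict[of C D b "B \<inter> C"] x e BC by auto
  ultimately show ?thesis using index_pos[OF BC] e by (simp add: index_ratio_def Let_def)
qed

text \<open>A prime \<open>p\<close> beyond the indices attached to finitely many generators divides
  none of them, so the ratios of all classes are prime to \<open>p\<close> above and below. The
  witness for this \<open>p\<close> has a ratio with \<open>p\<close> in the numerator only.\<close>

theorem commensurator_not_fg:
  assumes wit: "\<And>p::nat. prime p \<Longrightarrow> \<exists>A B \<alpha>. (A, B, \<alpha>) \<in> commensurations G \<and>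
     \<not> p dvd card (rcosets A) \<and> p dvd card (rcosets B)"
  shows "\<not> finitely_generated_group (commensurator G)"
proof
  let ?Com = "commensurator G" and ?q = "\<lambda>x. commens_rel G `` {x}"
  assume "finitely_generated_group ?Com"
  then obtain S where S: "finite S" "S \<subseteq> carrier ?Com" "generate ?Com S = carrier ?Com"
    by (auto simp: finitely_generated_group_def)
  interpret C: group ?Com by (rule commensurator_group)
  have carr: "\<exists>x \<in> commensurations G. X = ?q x" if "X \<in> carrier ?Com" for X
    using that by (auto simp: commensurator_def elim: quotientE)
  have qC: "?q x \<in> carrier ?Com" if "x \<in> commensurations G" for x
    using that by (auto simp: commensurator_def intro: quotientI)
  have q_ratio: "index_ratio x = index_ratio y" if "?q x = ?q y" "y \<in> commensurations G" for x y
    using that index_ratio_cong eq_equiv_class[OF _ comm_equiv] by blast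
  obtain r where r: "\<And>X. X \<in> S \<Longrightarrow> r X \<in> commensurations G \<and> X = ?q (r X)"
    using S(2) carr by (metis subsetD)
  \<comment> \<open>\<open>N\<close> bounds the domain and codomain indices of the chosen
    representatives; the inserted \<open>0\<close> keeps \<open>Max\<close> meaningful for empty
    \<open>S\<close>.\<close>
  define N where "N = Max (insert 0 ((\<lambda>X. card (rcosets (fst (r X)))) ` S \<union> (\<lambda>X. card (rcosets (fst (snd (r X))))) ` S))"
  obtain p :: nat where p: "prime p" "p > N" using bigger_prime by blast
  \<comment> \<open>These are the positive rationals of \<open>p\<close>-adic valuation 0. Since
    \<open>p\<close> divides 0, neither \<open>m\<close> nor \<open>n\<close> can vanish.\<close>
  define U where "U = {real m / real n | m n. \<not> p dvd m \<and> \<not> p dvd n}"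
  have "\<not> p dvd 1" "(1::real) = real 1 / real 1" using p(1) by (auto simp: prime_nat_iff)
  then have U1: "1 \<in> U" unfolding U_def by blast
  have Umult: "u * v \<in> U" if uv: "u \<in> U" "v \<in> U" for u v
  proof -
    obtain a b c d where "u = real a / real b" "v = real c / real d"
      "\<not> p dvd a" "\<not> p dvd b" "\<not> p dvd c" "\<not> p dvd d" using uv unfolding U_def by blast
    then have "u * v = real (a * c) / real (b * d)" "\<not> p dvd a * c" "\<not> p dvd b * d"
      using p(1) by (auto simp: prime_dvd_mult_iff)
    then show ?thesis unfolding U_def by blast
  qed
  have Uinv: "inverse u \<in> U" if u: "u \<in> U" for u
  proof -
    obtain a b where "u = real a / real b" "\<not> p dvd a" "\<not> p dvd b" using u unfolding U_def by blast
    then show ?thesis unfolding U_def by (metis (mono_tags, lifting) CollectI inverse_divide)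
  qed
  have ratio_one: "index_ratio (carrier G, carrier G, \<lambda>x\<in>carrier G. x) = 1"
    using index_pos[OF fi_carrier] by (simp add: index_ratio_def)
  have oneC: "(carrier G, carrier G, \<lambda>x\<in>carrier G. x) \<in> commensurations G"
    using fi_carrier by (auto simp: commensurations_def iso_def hom_def bij_betw_def inj_on_def)
  have one_eq: "\<one>\<^bsub>?Com\<^esub> = ?q (carrier G, carrier G, \<lambda>x\<in>carrier G. x)" by (simp add: commensurator_def)
  have rU: "index_ratio (r X) \<in> U" if "X \<in> S" for X
  proof -
    obtain A B a where e: "r X = (A, B, a)" by (metis prod_cases3)
    have f: "finite_index_subgroup A G" "finite_index_subgroup B G"
      using r[OF that] e by (auto simp: commensurations_def)
    have "card (rcosets (fst (r X))) \<le> N" "card (rcosets (fst (snd (r X)))) \<le> N"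
      unfolding N_def using that S(1) by (auto intro!: Max_ge)
    then have "card (rcosets A) \<le> N" "card (rcosets B) \<le> N" using e by auto
    moreover have "card (rcosets A) > 0" "card (rcosets B) > 0" using index_pos f by auto
    ultimately have "\<not> p dvd card (rcosets A)" "\<not> p dvd card (rcosets B)"
      using p(2) by (auto dest!: dvd_imp_le)
    then show ?thesis unfolding U_def index_ratio_def e fst_conv snd_conv by blast
  qed
  \<comment> \<open>\<open>U\<close> is closed under products and inverses, so induction over
    \<open>generate\<close> applies; one representative suffices because the ratio depends on the
    class only.\<close>
  have gen: "\<exists>x \<in> commensurations G. X = ?q x \<and> index_ratio x \<in> U" if "X \<in> generate ?Com S" for X
    using that
  proof (induction rule: generate.induct)
    case one
    then show ?case using one_eq oneC U1 ratio_one by (intro bexI[OF _ oneC]) simp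
  next
    case (incl X)
    then show ?case using r rU by blast
  next
    case (inv X)
    have XC: "X \<in> carrier ?Com" using inv S by auto
    then obtain y where y: "y \<in> commensurations G" "inv\<^bsub>?Com\<^esub> X = ?q y" using carr C.inv_closed by blast
    have rX: "r X \<in> commensurations G" "X = ?q (r X)" using r[OF inv] by auto
    \<comment> \<open>The product of the two classes is the identity, so the ratio of
      \<open>y\<close> is the reciprocal of that of \<open>r X\<close>.\<close>
    have "?q (commens_comp y (r X)) = ?q y \<otimes>\<^bsub>?Com\<^esub> ?q (r X)"
      using commens_mult[OF y(1) rX(1)] by (rule sym)
    also have "\<dots> = \<one>\<^bsub>?Com\<^esub>" using C.l_inv[OF XC] y(2) rX(2) by metis
    finally have "index_ratio (commens_comp y (r X)) = 1"
      using q_ratio[OF _ oneC] one_eq ratio_one by simp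
    then have "index_ratio y * index_ratio (r X) = 1" using index_ratio_comp[OF y(1) rX(1)] by simp
    then have "index_ratio y = inverse (index_ratio (r X))" by (metis inverse_unique mult.commute)
    then have "index_ratio y \<in> U" using rU[OF inv] Uinv by simp
    then show ?case using y by blast
  next
    case (eng X Y)
    then obtain x y where xy: "x \<in> commensurations G" "X = ?q x" "index_ratio x \<in> U"
      "y \<in> commensurations G" "Y = ?q y" "index_ratio y \<in> U" by blast
    moreover have "commens_comp x y \<in> commensurations G"
      using xy commens_comp_closed by (metis prod_cases3)
    ultimately show ?case using commens_mult[of x y] index_ratio_comp[of x y] Umult
      by (intro bexI[of _ "commens_comp x y"]) auto
  qed
  obtain A B \<alpha> where w: "(A, B, \<alpha>) \<in> commensurations G" "\<not> p dvd card (rcosets A)" "p dvd card (rcosets B)"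
    using wit p(1) by blast
  then obtain x where x: "x \<in> commensurations G" "?q (A, B, \<alpha>) = ?q x" "index_ratio x \<in> U"
    using gen[of "?q (A, B, \<alpha>)"] qC S(3) by blast
  then have "index_ratio (A, B, \<alpha>) \<in> U" using q_ratio[OF x(2,1)] by simp
  then obtain m n where mn: "\<not> p dvd m" "\<not> p dvd n"
    "real (card (rcosets B)) / real (card (rcosets A)) = real m / real n"
    by (auto simp: U_def index_ratio_def)
  have "card (rcosets A) > 0" "n > 0" using w index_pos mn by (auto simp: commensurations_def intro: gr0I)
  \<comment> \<open>After cross-multiplying, \<open>p\<close> divides the left side through the
    index of \<open>B\<close>, but neither factor on the right.\<close>
  then have "real (card (rcosets B) * n) = real (m * card (rcosets A))" using mn(3) by (simp add: field_simps)
  then have "card (rcosets B) * n = m * card (rcosets A)" using of_nat_eq_iff by blast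
  then have "p dvd m * card (rcosets A)" using w(3) by (metis dvd_mult2)
  then show False using p(1) mn(1) w(2) prime_dvd_mult_iff by blast
qed

end

section \<open>Dyadic piecewise linear homeomorphisms\<close>

lemma dyadic_add: "x \<in> dyadic_rationals \<Longrightarrow> y \<in> dyadic_rationals \<Longrightarrow> x + y \<in> dyadic_rationals"
proof -
  assume "x \<in> dyadic_rationals" "y \<in> dyadic_rationals"
  then obtain m n m' n' where "x = of_int m / 2 ^ n" "y = of_int m' / 2 ^ n'"
    unfolding dyadic_rationals_def by blast
  then have "x + y = of_int (m * 2 ^ n' + m' * 2 ^ n) / 2 ^ (n + n')"
    by (simp add: add_frac_eq power_add)
  then show ?thesis unfolding dyadic_rationals_def by blast
qed

lemma dyadic_mult: "x \<in> dyadic_rationals \<Longrightarrow> y \<in> dyadic_rationals \<Longrightarrow> x * y \<in> dyadic_rationals"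
proof -
  assume "x \<in> dyadic_rationals" "y \<in> dyadic_rationals"
  then obtain m n m' n' where "x = of_int m / 2 ^ n" "y = of_int m' / 2 ^ n'"
    unfolding dyadic_rationals_def by blast
  then have "x * y = of_int (m * m') / 2 ^ (n + n')"
    by (simp only: times_divide_times_eq power_add of_int_mult)
  then show ?thesis unfolding dyadic_rationals_def by blast
qed

lemma dyadic_of_int: "of_int m \<in> dyadic_rationals"
proof -
  have "(of_int m :: real) = of_int m / 2 ^ 0" by simp
  then show ?thesis unfolding dyadic_rationals_def by blast
qed

lemma dyadic_uminus: "x \<in> dyadic_rationals \<Longrightarrow> - x \<in> dyadic_rationals"
  using dyadic_mult[OF dyadic_of_int[of "-1"]] by simp

lemma dyadic_diff: "x \<in> dyadic_rationals \<Longrightarrow> y \<in> dyadic_rationals \<Longrightarrow> x - y \<in> dyadic_rationals"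
  using dyadic_add[OF _ dyadic_uminus] by fastforce

lemma dyadic_powi: "2 powi k \<in> dyadic_rationals"
proof (cases "k \<ge> 0")
  case True
  then have "(2::real) powi k = of_int (2 ^ nat k) / 2 ^ 0" by (simp add: power_int_def)
  then show ?thesis unfolding dyadic_rationals_def by blast
next
  case False
  then have "(2::real) powi k = of_int 1 / 2 ^ nat (- k)"
    by (simp add: power_int_def inverse_eq_divide power_one_over)
  then show ?thesis unfolding dyadic_rationals_def by blast
qed

lemmas dyadic_intros = dyadic_add dyadic_mult dyadic_of_int dyadic_uminus dyadic_diff dyadic_powi

text \<open>Multiples of some 1 / 2^n smaller than the gap cannot skip the interval. A dyadic base
  point found this way later fixes the constant term of an affine piece.\<close>

lemma dyadic_dense:
  assumes "(a::real) < c" obtains t where "t \<in> dyadic_rationals" "a < t" "t < c"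
proof -
  obtain n where "inverse ((2::real) ^ n) < c - a"
    using real_arch_pow_inv[of "c - a" "1/2"] assms by (auto simp: power_one_over inverse_eq_divide)
  then have n: "1 < (c - a) * 2 ^ n" by (simp add: field_simps)
  let ?m = "\<lfloor>a * 2 ^ n\<rfloor> + 1"
  have "a * 2 ^ n < of_int ?m" "of_int ?m \<le> a * 2 ^ n + 1" by linarith+
  then have "a * 2 ^ n < of_int ?m" "of_int ?m < c * 2 ^ n" using n unfolding left_diff_distrib by linarith+
  then have "a < of_int ?m / 2 ^ n" "of_int ?m / 2 ^ n < c" by (simp_all only: pos_less_divide_eq pos_divide_less_eq zero_less_power zero_less_numeral)
  then show ?thesis using that unfolding dyadic_rationals_def by blast
qed

text \<open>A filter in place of a point lets one notion cover left germs, right germs and full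
  neighbourhoods. The slopes are units of the dyadic ring and \<open>b\<close> is dyadic, so these
  affine maps form a group.\<close>

definition dyadic_affine :: "(real \<Rightarrow> real) \<Rightarrow> real filter \<Rightarrow> bool" where
  "dyadic_affine f F \<longleftrightarrow> (\<exists>k::int. \<exists>b\<in>dyadic_rationals. \<forall>\<^sub>F t in F. f t = 2 powi k * t + b)"

lemma dyadic_affine_comp:
  assumes "dyadic_affine g F" "dyadic_affine f G" "filterlim g G F"
  shows "dyadic_affine (f \<circ> g) F"
proof -
  obtain k b where g: "b \<in> dyadic_rationals" "\<forall>\<^sub>F t in F. g t = 2 powi k * t + b"
    using assms(1) by (auto simp: dyadic_affine_def)
  obtain j c where f: "c \<in> dyadic_rationals" "\<forall>\<^sub>F t in G. f t = 2 powi j * t + c"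
    using assms(2) by (auto simp: dyadic_affine_def)
  have "\<forall>\<^sub>F t in F. f (g t) = 2 powi j * g t + c"
    using f(2) assms(3) by (rule eventually_compose_filterlim)
  then have "\<forall>\<^sub>F t in F. (f \<circ> g) t = 2 powi (j + k) * t + (2 powi j * b + c)"
    using g(2) by eventually_elim (simp add: power_int_add algebra_simps)
  moreover have "2 powi j * b + c \<in> dyadic_rationals" using g f by (intro dyadic_intros)
  ultimately show ?thesis unfolding dyadic_affine_def by blast
qed

text \<open>Solving \<open>2 powi k * g s + b = s\<close> for \<open>g s\<close> gives slope
  \<open>2 powi (-k)\<close> and a constant term that is again dyadic, because powers of 2 are
  invertible among the dyadics.\<close>

lemma dyadic_affine_inverse:
  assumes "dyadic_affine f G" "filterlim g G F" "\<And>s. f (g s) = s"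
  shows "dyadic_affine g F"
proof -
  obtain k b where f: "b \<in> dyadic_rationals" "\<forall>\<^sub>F t in G. f t = 2 powi k * t + b"
    using assms(1) by (auto simp: dyadic_affine_def)
  have "\<forall>\<^sub>F s in F. f (g s) = 2 powi k * g s + b"
    using f(2) assms(2) by (rule eventually_compose_filterlim)
  then have "\<forall>\<^sub>F s in F. g s = 2 powi (-k) * s + (- (2 powi (-k) * b))"
    by eventually_elim (simp add: assms(3) power_int_minus field_simps)
  moreover have "- (2 powi (-k) * b) \<in> dyadic_rationals" using f by (intro dyadic_intros)
  ultimately show ?thesis unfolding dyadic_affine_def by blast
qed

text \<open>Stating piecewise linearity by one-sided germs makes closure under composition and inversion
  immediate, because breakpoints that cancel in a composition need no separate treatment.\<close>

definition dyadic_pl :: "(real \<Rightarrow> real) \<Rightarrow> bool" where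
  "dyadic_pl f \<longleftrightarrow> strict_mono f \<and> surj f \<and>
     (\<forall>x. dyadic_affine f (at_left x) \<and> dyadic_affine f (at_right x)) \<and>
     (\<forall>x. x \<notin> dyadic_rationals \<longrightarrow> dyadic_affine f (nhds x))"

section \<open>Increasing bijections of the line\<close>

lemma strict_mono_surj_continuous:
  fixes f :: "real \<Rightarrow> real"
  assumes "strict_mono f" "surj f"
  shows "continuous_on UNIV f"
  by (rule continuous_onI_mono) (use assms strict_mono_less_eq in auto)

lemma strict_mono_surj_inv:
  fixes f :: "real \<Rightarrow> real"
  assumes "strict_mono f" "surj f"
  shows "strict_mono (inv_into UNIV f)" "surj (inv_into UNIV f)"
proof -
  have i: "inj f" using assms(1) strict_mono_on_imp_inj_on by blast
  show "strict_mono (inv_into UNIV f)" using strict_mono_inv[OF assms] i by (simp add: inv_f_f)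
  show "surj (inv_into UNIV f)" using i by (simp add: inj_imp_surj_inv)
qed

text \<open>An increasing bijection is continuous and respects sides and ends. These limits are what
  composing and inverting germs requires.\<close>

lemma strict_mono_surj_filterlim:
  fixes f :: "real \<Rightarrow> real"
  assumes "strict_mono f" "surj f"
  shows "filterlim f (nhds (f x)) (nhds x)" "filterlim f (at_right (f x)) (at_right x)"
    "filterlim f (at_left (f x)) (at_left x)" "filterlim f at_top at_top" "filterlim f at_bot at_bot"
proof -
  have c: "(f \<longlongrightarrow> f x) (at x)"
    using strict_mono_surj_continuous[OF assms] by (simp add: continuous_on_eq_continuous_at continuous_at)
  then show "filterlim f (nhds (f x)) (nhds x)" by (simp add: tendsto_at_iff_tendsto_nhds)
  show "filterlim f (at_right (f x)) (at_right x)"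
    unfolding filterlim_at
  proof
    show "(f \<longlongrightarrow> f x) (at_right x)" using c by (rule tendsto_within_subset) simp
    show "\<forall>\<^sub>F t in at_right x. f t \<in> {f x<..} \<and> f t \<noteq> f x"
      using assms(1) by (intro eventually_at_rightI[of x "x + 1"]) (auto simp: strict_mono_less strict_mono_eq)
  qed
  show "filterlim f (at_left (f x)) (at_left x)"
    unfolding filterlim_at
  proof
    show "(f \<longlongrightarrow> f x) (at_left x)" using c by (rule tendsto_within_subset) simp
    show "\<forall>\<^sub>F t in at_left x. f t \<in> {..<f x} \<and> f t \<noteq> f x"
      using assms(1) by (intro eventually_at_leftI[of "x - 1" x]) (auto simp: strict_mono_less strict_mono_eq)
  qed
  show "filterlim f at_top at_top" unfolding filterlim_at_top
  proof
    fix Z obtain z where "f z = Z" using assms(2) by (metis surjD)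
    then show "\<forall>\<^sub>F x in at_top. Z \<le> f x"
      using assms(1) by (auto intro: eventually_at_top_linorderI[of z] simp: strict_mono_less_eq)
  qed
  show "filterlim f at_bot at_bot" unfolding filterlim_at_bot
  proof
    fix Z obtain z where "f z = Z" using assms(2) by (metis surjD)
    then show "\<forall>\<^sub>F x in at_bot. f x \<le> Z"
      using assms(1) by (auto simp: eventually_at_bot_linorder strict_mono_less_eq)
  qed
qed

text \<open>Continuity extends the right-hand affine expression to \<open>x\<close> itself, and this
  affine map is invertible over the dyadics. Non-dyadic points thus go to non-dyadic points, where
  two-sided germs are available for composition.\<close>

lemma dyadic_pl_value:
  assumes "dyadic_pl f"
  shows "f x \<in> dyadic_rationals \<longleftrightarrow> x \<in> dyadic_rationals"
proof -
  have f: "strict_mono f" "surj f" "dyadic_affine f (at_right x)" using assms by (auto simp: dyadic_pl_def)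
  obtain k b where kb: "b \<in> dyadic_rationals" "\<forall>\<^sub>F t in at_right x. f t = 2 powi k * t + b"
    using f(3) by (auto simp: dyadic_affine_def)
  have "((\<lambda>t. 2 powi k * t + b) \<longlongrightarrow> 2 powi k * x + b) (at_right x)" by (intro tendsto_intros)
  then have "(f \<longlongrightarrow> 2 powi k * x + b) (at_right x)"
    using kb(2) by (subst tendsto_cong) 
  moreover have "(f \<longlongrightarrow> f x) (at_right x)"
    using strict_mono_surj_filterlim(2)[OF f(1,2)] by (simp add: filterlim_at)
  ultimately have e: "f x = 2 powi k * x + b" using tendsto_unique by (metis trivial_limit_at_right_real)
  then have "x = 2 powi (-k) * (f x - b)" by (simp add: power_int_minus)
  then have "f x \<in> dyadic_rationals \<Longrightarrow> x \<in> dyadic_rationals"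
    using dyadic_mult[OF dyadic_powi dyadic_diff[OF _ kb(1)], of "f x" "-k"] by simp
  moreover have "x \<in> dyadic_rationals \<Longrightarrow> f x \<in> dyadic_rationals"
    unfolding e by (intro dyadic_intros kb(1))
  ultimately show ?thesis by blast
qed

section \<open>Closure under composition and inversion\<close>

lemma dyadic_pl_id: "dyadic_pl id"
  unfolding dyadic_pl_def dyadic_affine_def
  using dyadic_of_int[of 0] by (auto simp: strict_mono_def intro!: exI[of _ 0] bexI[of _ 0])

lemma dyadic_pl_comp:
  assumes "dyadic_pl f" "dyadic_pl g"
  shows "dyadic_pl (f \<circ> g)"
proof -
  have g: "strict_mono g" "surj g" and f: "strict_mono f" "surj f" using assms by (auto simp: dyadic_pl_def)
  have "dyadic_affine (f \<circ> g) (nhds x)" if "x \<notin> dyadic_rationals" for x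
    using assms that dyadic_pl_value[OF assms(2), of x]
    by (intro dyadic_affine_comp[OF _ _ strict_mono_surj_filterlim(1)[OF g]]) (auto simp: dyadic_pl_def)
  moreover have "dyadic_affine (f \<circ> g) (at_right x)" for x
    using assms by (intro dyadic_affine_comp[OF _ _ strict_mono_surj_filterlim(2)[OF g]]) (auto simp: dyadic_pl_def)
  moreover have "dyadic_affine (f \<circ> g) (at_left x)" for x
    using assms by (intro dyadic_affine_comp[OF _ _ strict_mono_surj_filterlim(3)[OF g]]) (auto simp: dyadic_pl_def)
  moreover have "strict_mono (f \<circ> g)" using f(1) g(1) by (auto simp: strict_mono_def)
  moreover have "surj (f \<circ> g)" using comp_surj[OF g(2) f(2)] .
  ultimately show ?thesis unfolding dyadic_pl_def by blast
qed

lemma dyadic_pl_inv: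
  assumes "dyadic_pl f"
  shows "dyadic_pl (inv_into UNIV f)"
proof -
  let ?g = "inv_into UNIV f"
  have f: "strict_mono f" "surj f" using assms by (auto simp: dyadic_pl_def)
  note g = strict_mono_surj_inv[OF f]
  have fg: "f (?g s) = s" for s using f(2) by (simp add: surj_f_inv_f)
  have "dyadic_affine ?g (nhds x)" if "x \<notin> dyadic_rationals" for x
    using assms that dyadic_pl_value[OF assms, of "?g x"]
    by (intro dyadic_affine_inverse[OF _ strict_mono_surj_filterlim(1)[OF g] fg]) (auto simp: dyadic_pl_def fg)
  moreover have "dyadic_affine ?g (at_right x)" for x
    using assms by (intro dyadic_affine_inverse[OF _ strict_mono_surj_filterlim(2)[OF g] fg]) (auto simp: dyadic_pl_def)
  moreover have "dyadic_affine ?g (at_left x)" for x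
    using assms by (intro dyadic_affine_inverse[OF _ strict_mono_surj_filterlim(3)[OF g] fg]) (auto simp: dyadic_pl_def)
  ultimately show ?thesis using g by (auto simp: dyadic_pl_def)
qed

section \<open>Germs and breakpoints\<close>

lemma affine_not_breakpoint:
  assumes "open U" "x \<in> U" "\<And>t. t \<in> U \<Longrightarrow> f t = a * t + b"
  shows "x \<notin> breakpoints f"
  using assms unfolding breakpoints_def eventually_nhds by blast

lemma dyadic_affine_right_interval:
  assumes "dyadic_affine f (at_right x)"
  obtains c k b where "x < c" "b \<in> dyadic_rationals" "\<And>t. x < t \<Longrightarrow> t < c \<Longrightarrow> f t = 2 powi k * t + b"
  using assms unfolding dyadic_affine_def eventually_at_right_field by blast

lemma dyadic_affine_left_interval:
  assumes "dyadic_affine f (at_left x)"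
  obtains c k b where "c < x" "b \<in> dyadic_rationals" "\<And>t. c < t \<Longrightarrow> t < x \<Longrightarrow> f t = 2 powi k * t + b"
  using assms unfolding dyadic_affine_def eventually_at_left_field by blast

text \<open>On each side of \<open>x\<close> the map is affine on a short open interval, which
  contains no breakpoint. With Bolzano-Weierstrass this yields finiteness on bounded
  intervals.\<close>

lemma breakpoints_isolated:
  assumes "dyadic_affine f (at_left x)" "dyadic_affine f (at_right x)"
  shows "\<not> x islimpt breakpoints f"
proof -
  obtain c k b where c: "x < c" "\<And>t. x < t \<Longrightarrow> t < c \<Longrightarrow> f t = 2 powi k * t + b"
    using dyadic_affine_right_interval[OF assms(2)] by metis
  obtain d l e where d: "d < x" "\<And>t. d < t \<Longrightarrow> t < x \<Longrightarrow> f t = 2 powi l * t + e"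
    using dyadic_affine_left_interval[OF assms(1)] by metis
  have "\<forall>\<^sub>F t in at_right x. t \<notin> breakpoints f"
    using c(1) affine_not_breakpoint[of "{x<..<c}" _ f "2 powi k" b] c(2)
    by (auto intro!: eventually_at_rightI[of x c])
  moreover have "\<forall>\<^sub>F t in at_left x. t \<notin> breakpoints f"
    using d(1) affine_not_breakpoint[of "{d<..<x}" _ f "2 powi l" e] d(2)
    by (auto intro!: eventually_at_leftI[of d x])
  ultimately show ?thesis by (simp add: islimpt_iff_eventually eventually_at_split)
qed

text \<open>Off the breakpoints the derivative is locally constant, hence constant on the connected
  interval, and its value is a power of 2. A dyadic point of the interval then shows that the
  constant term is dyadic.\<close>

lemma affine_if_no_breakpoints:
  assumes "a < c" "{a<..<c} \<inter> breakpoints f = {}"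
    and der: "\<And>t. t \<notin> breakpoints f \<Longrightarrow> \<exists>k::int. (f has_real_derivative 2 powi k) (at t)"
    and dyad: "f ` dyadic_rationals \<subseteq> dyadic_rationals"
  shows "\<exists>k::int. \<exists>b\<in>dyadic_rationals. \<forall>t\<in>{a<..<c}. f t = 2 powi k * t + b"
proof -
  let ?I = "{a<..<c}"
  have loc: "\<forall>\<^sub>F s in at t within ?I. deriv f t = deriv f s" if t: "t \<in> ?I" for t
  proof -
    obtain m b where "\<forall>\<^sub>F s in nhds t. f s = m * s + b" using t assms(2) unfolding breakpoints_def by blast
    then obtain U where U: "open U" "t \<in> U" "\<And>s. s \<in> U \<Longrightarrow> f s = m * s + b" by (auto simp: eventually_nhds)
    have "(f has_real_derivative m) (at s)" if "s \<in> U" for s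
    proof (rule has_field_derivative_transform_within_open[OF _ U(1) that])
      show "((\<lambda>s. m * s + b) has_real_derivative m) (at s)" by (auto intro!: derivative_eq_intros)
    qed (simp add: U(3))
    then have "deriv f s = m" if "s \<in> U" for s using that by (simp add: DERIV_imp_deriv)
    then show ?thesis using U(1,2) unfolding eventually_at_topological by metis
  qed
  obtain u where u: "u \<in> dyadic_rationals" "u \<in> ?I" using dyadic_dense[OF assms(1)] by auto
  obtain k :: int where k: "(f has_real_derivative 2 powi k) (at u)" using der u assms(2) by blast
  have der': "(f has_real_derivative 2 powi k) (at t)" if t: "t \<in> ?I" for t
  proof -
    obtain j :: int where j: "(f has_real_derivative 2 powi j) (at t)" using der t assms(2) by blast
    have "deriv f t = deriv f u" using connected_local_const[OF _ t u(2)] loc connected_Ioo by blast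
    then show ?thesis using j k by (metis DERIV_imp_deriv)
  qed
  have const: "f t - 2 powi k * t = f u - 2 powi k * u" if t: "t \<in> ?I" for t
  proof (rule DERIV_isconst3[OF assms(1) t u(2)])
    fix s assume "s \<in> ?I"
    then show "((\<lambda>t. f t - 2 powi k * t) has_real_derivative 0) (at s)"
      using der' by (auto intro!: derivative_eq_intros)
  qed
  have "f u - 2 powi k * u \<in> dyadic_rationals" using u dyad by (intro dyadic_intros) auto
  then show ?thesis using const by (intro exI[of _ k] bexI[of _ "f u - 2 powi k * u"]) (auto simp: algebra_simps)
qed

text \<open>Links germs to the clauses of \<open>thompson_F_maps\<close> apart from the behaviour at
  the ends. Forward, isolated breakpoints are finite in number on compact intervals; backward,
  finiteness leaves breakpoint-free intervals beside every point.\<close>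

lemma dyadic_pl_iff:
  "dyadic_pl f \<longleftrightarrow> (\<exists>g. homeomorphism UNIV UNIV f g) \<and> mono f \<and>
     (\<forall>a b. finite (breakpoints f \<inter> {a..b})) \<and>
     breakpoints f \<subseteq> dyadic_rationals \<and>
     (\<forall>t. t \<notin> breakpoints f \<longrightarrow> (\<exists>k::int. (f has_real_derivative 2 powi k) (at t))) \<and>
     f ` dyadic_rationals \<subseteq> dyadic_rationals" (is "_ \<longleftrightarrow> ?R")
proof
  assume f: "dyadic_pl f"
  then have sm: "strict_mono f" "surj f" and germ: "\<And>x. dyadic_affine f (at_left x)" "\<And>x. dyadic_affine f (at_right x)"
    and nd: "\<And>x. x \<notin> dyadic_rationals \<Longrightarrow> dyadic_affine f (nhds x)" by (auto simp: dyadic_pl_def)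
  have "homeomorphism UNIV UNIV f (inv_into UNIV f)"
    using sm strict_mono_surj_inv[OF sm] strict_mono_surj_continuous
    by (auto simp: homeomorphism_def surj_f_inv_f strict_mono_on_imp_inj_on inv_f_f)
  moreover have "finite (breakpoints f \<inter> {a..b})" for a b
  proof (rule ccontr)
    assume "infinite (breakpoints f \<inter> {a..b})"
    then obtain x where "x islimpt breakpoints f \<inter> {a..b}"
      using bounded_infinite_imp_islimpt[of "breakpoints f \<inter> {a..b}"] 
      by (meson bounded_Int bounded_closed_interval subset_refl)
    then show False using breakpoints_isolated germ islimpt_subset by blast
  qed
  moreover have "breakpoints f \<subseteq> dyadic_rationals"
    using nd by (force simp: breakpoints_def dyadic_affine_def)
  moreover have "\<exists>k::int. (f has_real_derivative 2 powi k) (at t)" if t: "t \<notin> breakpoints f" for t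
  proof -
    obtain m b where "\<forall>\<^sub>F s in nhds t. f s = m * s + b" using t unfolding breakpoints_def by blast
    then obtain U where U: "open U" "t \<in> U" "\<And>s. s \<in> U \<Longrightarrow> f s = m * s + b" by (auto simp: eventually_nhds)
    have d: "(f has_real_derivative m) (at t)"
    proof (rule has_field_derivative_transform_within_open[OF _ U(1,2)])
      show "((\<lambda>s. m * s + b) has_real_derivative m) (at t)" by (auto intro!: derivative_eq_intros)
    qed (simp add: U(3))
    obtain k b' where kb: "\<forall>\<^sub>F s in at_right t. f s = 2 powi k * s + b'"
      using germ(2)[of t] by (auto simp: dyadic_affine_def)
    obtain c where c: "c > t" "\<And>s. t < s \<Longrightarrow> s < c \<Longrightarrow> f s = 2 powi k * s + b'"
      using kb by (auto simp: eventually_at_right_field)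
    obtain e where e: "e > 0" "\<And>s. \<bar>s - t\<bar> < e \<Longrightarrow> s \<in> U" using U(1,2) by (auto simp: open_dist dist_real_def)
    \<comment> \<open>Both \<open>t + h\<close> and \<open>t + 2 * h\<close> lie where the two
      affine expressions for \<open>f\<close> hold; the difference of the values identifies
      \<open>m\<close> with a power of 2.\<close>
    define h where "h = min (c - t) e / 3"
    have "3 * h \<le> c - t" "3 * h \<le> e" "h > 0" using c(1) e(1) by (auto simp: h_def)
    then have h: "h > 0" "t + 2 * h < c" "2 * h < e" by linarith+
    have "f (t + h) = m * (t + h) + b" "f (t + 2 * h) = m * (t + 2 * h) + b"
      using U(3) e h by auto
    then have "f (t + 2 * h) - f (t + h) = m * h" by (simp only:) (simp add: algebra_simps)
    moreover have "f (t + h) = 2 powi k * (t + h) + b'" "f (t + 2 * h) = 2 powi k * (t + 2 * h) + b'"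
      using c(2) h by auto
    then have "f (t + 2 * h) - f (t + h) = 2 powi k * h" by (simp only:) (simp add: algebra_simps)
    ultimately have "m * h = 2 powi k * h" by (rule trans[OF sym])
    then show ?thesis using d h(1) by auto
  qed
  moreover have "f ` dyadic_rationals \<subseteq> dyadic_rationals" using dyadic_pl_value[OF f] by auto
  ultimately show ?R using sm strict_mono_mono by blast
next
  assume R: ?R
  then obtain g where g: "homeomorphism UNIV UNIV f g" by blast
  have "inj f" "surj f" using g by (auto simp: homeomorphism_def intro: inj_on_inverseI)
  then have sm: "strict_mono f" using R by (simp add: strict_mono_iff_mono)
  note int = affine_if_no_breakpoints[of _ _ f]
  \<comment> \<open>A finite set has no limit point, so a window of radius 1 suffices to find a
    punctured neighbourhood of \<open>x\<close> free of breakpoints.\<close>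
  have fin: "\<forall>\<^sub>F t in at x. t \<notin> breakpoints f" for x
  proof -
    have "\<not> x islimpt (breakpoints f \<inter> {x-1..x+1})" using R islimpt_finite by blast
    then have "\<forall>\<^sub>F t in at x. t \<notin> breakpoints f \<inter> {x-1..x+1}" by (simp add: islimpt_iff_eventually)
    moreover have "\<forall>\<^sub>F t in at x. t \<in> {x-1<..<x+1}"
      by (rule eventually_at_in_open') auto
    ultimately show ?thesis by eventually_elim auto
  qed
  have "dyadic_affine f (at_left x)" for x
  proof -
    have "\<forall>\<^sub>F t in at_left x. t \<notin> breakpoints f" using fin[of x] by (simp add: eventually_at_split)
    then obtain c where c: "c < x" "\<And>t. c < t \<Longrightarrow> t < x \<Longrightarrow> t \<notin> breakpoints f" by (auto simp: eventually_at_left_field)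
    then obtain k b where "b \<in> dyadic_rationals" "\<forall>t\<in>{c<..<x}. f t = 2 powi k * t + b"
      using int[of c x] R by fastforce
    then show ?thesis using c(1) unfolding dyadic_affine_def eventually_at_left_field
      by (metis greaterThanLessThan_iff)
  qed
  moreover have "dyadic_affine f (at_right x)" for x
  proof -
    have "\<forall>\<^sub>F t in at_right x. t \<notin> breakpoints f" using fin[of x] by (simp add: eventually_at_split)
    then obtain c where c: "x < c" "\<And>t. x < t \<Longrightarrow> t < c \<Longrightarrow> t \<notin> breakpoints f" by (auto simp: eventually_at_right_field)
    then obtain k b where "b \<in> dyadic_rationals" "\<forall>t\<in>{x<..<c}. f t = 2 powi k * t + b"
      using int[of x c] R by fastforce
    then show ?thesis using c(1) unfolding dyadic_affine_def eventually_at_right_field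
      by (metis greaterThanLessThan_iff)
  qed
  moreover have "dyadic_affine f (nhds x)" if "x \<notin> dyadic_rationals" for x
  proof -
    have "x \<notin> breakpoints f" using that R by auto
    \<comment> \<open>As \<open>x\<close> itself is no breakpoint, the punctured neighbourhood
      becomes a full one.\<close>
    then have "\<forall>\<^sub>F t in nhds x. t \<notin> breakpoints f" using fin[of x]
      by (auto simp: eventually_at_filter elim!: eventually_mono)
    then obtain e where e: "e > 0" "\<And>t. \<bar>t - x\<bar> < e \<Longrightarrow> t \<notin> breakpoints f"
      by (auto simp: eventually_nhds_metric dist_real_def)
    have "{x-e<..<x+e} \<inter> breakpoints f = {}"
      using e(2) by (force simp: abs_less_iff)
    then obtain k b where kb: "b \<in> dyadic_rationals" "\<forall>t\<in>{x-e<..<x+e}. f t = 2 powi k * t + b"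
      using int[of "x-e" "x+e"] R e(1) by fastforce
    have "\<forall>\<^sub>F t in nhds x. t \<in> {x-e<..<x+e}" using e(1) by (intro eventually_nhds_in_open) auto
    then have "\<forall>\<^sub>F t in nhds x. f t = 2 powi k * t + b" by eventually_elim (use kb in auto)
    then show ?thesis using kb(1) unfolding dyadic_affine_def by blast
  qed
  ultimately show "dyadic_pl f" using sm \<open>surj f\<close> by (simp add: dyadic_pl_def)
qed

section \<open>Commensurations of Thompson's group\<close>

text \<open>The kernel of the translation length at +infinity reduced modulo \<open>n\<close>, with
  the length at -infinity left free; \<open>n = 1\<close> gives the whole group.\<close>

definition end_multiples :: "int \<Rightarrow> (real \<Rightarrow> real) set" where
  "end_multiples n = {f. dyadic_pl f \<and>
     (\<exists>j::int. \<forall>\<^sub>F t in at_top. f t = t + of_int (n * j)) \<and>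
     (\<exists>l::int. \<forall>\<^sub>F t in at_bot. f t = t + of_int l)}"

text \<open>One bound \<open>M\<close> for both ends amounts to two separate
  \<open>eventually\<close> statements; the remaining clauses are those of
  \<open>dyadic_pl_iff\<close>.\<close>

lemma thompson_F_maps_eq: "thompson_F_maps = end_multiples 1"
proof -
  have "(\<exists>(l::int) (r::int) (M::real). M > 0 \<and> (\<forall>t. t > M \<longrightarrow> f t = t + of_int r) \<and> (\<forall>t. t < - M \<longrightarrow> f t = t + of_int l))
    \<longleftrightarrow> (\<exists>j::int. \<forall>\<^sub>F t in at_top. f t = t + of_int j) \<and> (\<exists>l::int. \<forall>\<^sub>F t in at_bot. f t = t + of_int l)"
    (is "?L \<longleftrightarrow> ?R") for f :: "real \<Rightarrow> real"
  proof
    assume ?L then show ?R unfolding eventually_at_top_dense eventually_at_bot_dense by blast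
  next
    assume ?R
    then obtain r l :: int and N N' where
      N: "\<And>t. t > N \<Longrightarrow> f t = t + of_int r" "\<And>t. t < N' \<Longrightarrow> f t = t + of_int l"
      unfolding eventually_at_top_dense eventually_at_bot_dense by blast
    have "max 1 (max N (- N')) > 0 \<and> (\<forall>t. t > max 1 (max N (- N')) \<longrightarrow> f t = t + of_int r) \<and>
      (\<forall>t. t < - max 1 (max N (- N')) \<longrightarrow> f t = t + of_int l)"
      using N by auto
    then show ?L by blast
  qed
  then show ?thesis unfolding thompson_F_maps_def end_multiples_def dyadic_pl_iff by auto
qed

section \<open>Translations near the two ends\<close>

lemma dyadic_pl_strict: "dyadic_pl f \<Longrightarrow> strict_mono f" "dyadic_pl f \<Longrightarrow> surj f" "dyadic_pl f \<Longrightarrow> inj f"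
  by (auto simp: dyadic_pl_def strict_mono_on_imp_inj_on)

lemmas dyadic_pl_filterlim =
  strict_mono_surj_filterlim[OF dyadic_pl_strict(1,2)]

lemma dyadic_pl_translation: "dyadic_pl (\<lambda>t. t + of_int i)"
proof -
  have "dyadic_affine (\<lambda>t. t + of_int i) F" for F
    unfolding dyadic_affine_def using dyadic_of_int[of i] by (intro exI[of _ 0] bexI[of _ "of_int i"]) auto
  then show ?thesis by (auto simp: dyadic_pl_def strict_mono_def intro!: surjI[of _ "\<lambda>t. t - of_int i"])
qed

lemma eventually_translation:
  assumes "\<forall>\<^sub>F t in F. P t" "F = at_top \<or> F = at_bot"
  shows "\<forall>\<^sub>F t in F. P (t + real_of_int i)"
  using assms dyadic_pl_filterlim(4,5)[OF dyadic_pl_translation[of i] dyadic_pl_translation[of i]]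
    eventually_compose_filterlim by blast

lemma eventually_comp_translation:
  assumes "\<forall>\<^sub>F t in F. f t = t + of_int i" "\<forall>\<^sub>F t in F. g t = t + of_int j" "filterlim g F F"
  shows "\<forall>\<^sub>F t in F. (f \<circ> g) t = t + real_of_int (i + j)"
proof -
  have "\<forall>\<^sub>F t in F. f (g t) = g t + of_int i" using assms(1,3) by (rule eventually_compose_filterlim)
  then show ?thesis using assms(2) by eventually_elim simp
qed

lemma eventually_inv_translation:
  assumes "\<forall>\<^sub>F t in F. f t = t + real_of_int i" "F = at_top \<or> F = at_bot" "inj f"
  shows "\<forall>\<^sub>F t in F. inv_into UNIV f t = t + real_of_int (- i)"
  using eventually_translation[OF assms(1,2), of "- i"]
proof eventually_elim
  case (elim t)
  then have "f (t + of_int (- i)) = t" by simp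
  then show ?case using assms(3) by (metis inv_f_f)
qed

lemma end_multiples_comp:
  assumes "f \<in> end_multiples n" "g \<in> end_multiples n"
  shows "f \<circ> g \<in> end_multiples n"
proof -
  obtain i j l m where fg: "dyadic_pl f" "dyadic_pl g"
    "\<forall>\<^sub>F t in at_top. f t = t + of_int (n * i)" "\<forall>\<^sub>F t in at_top. g t = t + of_int (n * j)"
    "\<forall>\<^sub>F t in at_bot. f t = t + of_int l" "\<forall>\<^sub>F t in at_bot. g t = t + of_int m"
    using assms unfolding end_multiples_def by blast
  have "\<forall>\<^sub>F t in at_top. (f \<circ> g) t = t + of_int (n * (i + j))"
    using eventually_comp_translation[OF fg(3,4)] dyadic_pl_filterlim(4)[OF fg(2,2)] by (simp add: distrib_left)
  moreover have "\<forall>\<^sub>F t in at_bot. (f \<circ> g) t = t + of_int (l + m)"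
    using eventually_comp_translation[OF fg(5,6)] dyadic_pl_filterlim(5)[OF fg(2,2)] by simp
  ultimately show ?thesis using dyadic_pl_comp[OF fg(1,2)] unfolding end_multiples_def by blast
qed

lemma end_multiples_inv:
  assumes "f \<in> end_multiples n"
  shows "inv_into UNIV f \<in> end_multiples n"
proof -
  obtain i l where f: "dyadic_pl f"
    "\<forall>\<^sub>F t in at_top. f t = t + of_int (n * i)" "\<forall>\<^sub>F t in at_bot. f t = t + of_int l"
    using assms unfolding end_multiples_def by blast
  have "\<forall>\<^sub>F t in at_top. inv_into UNIV f t = t + of_int (n * (- i))"
    using eventually_inv_translation[OF f(2) _ dyadic_pl_strict(3)[OF f(1)]] by simp
  moreover have "\<forall>\<^sub>F t in at_bot. inv_into UNIV f t = t + of_int (- l)"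
    using eventually_inv_translation[OF f(3) _ dyadic_pl_strict(3)[OF f(1)]] by simp
  ultimately show ?thesis using dyadic_pl_inv[OF f(1)] unfolding end_multiples_def by blast
qed

lemma end_multiples_id: "id \<in> end_multiples n"
proof -
  have "\<forall>\<^sub>F t in at_top. id t = t + real_of_int (n * 0)" "\<forall>\<^sub>F t in at_bot. id t = t + real_of_int 0" by auto
  then show ?thesis using dyadic_pl_id unfolding end_multiples_def by blast
qed

lemma translation_in_end_multiples: "(\<lambda>t. t + of_int i) \<in> end_multiples 1"
proof -
  have "\<forall>\<^sub>F t in at_top. t + of_int i = t + real_of_int (1 * i)" "\<forall>\<^sub>F t in at_bot. t + of_int i = t + real_of_int i" by auto
  then show ?thesis using dyadic_pl_translation unfolding end_multiples_def by blast
qed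

lemma end_multiples_inv_comp:
  assumes "f \<in> end_multiples n"
  shows "inv_into UNIV f \<circ> f = id" "f \<circ> inv_into UNIV f = id"
  using assms dyadic_pl_strict[of f] by (auto simp: end_multiples_def surj_f_inv_f)

section \<open>Thompson's group and its subgroups of finite index\<close>

lemma thompson_F_simps:
  "carrier thompson_F = end_multiples 1" "\<one>\<^bsub>thompson_F\<^esub> = id" "f \<otimes>\<^bsub>thompson_F\<^esub> g = f \<circ> g"
  by (simp_all add: thompson_F_def thompson_F_maps_eq)

lemma thompson_F_group: "group thompson_F"
proof (rule groupI)
  fix f assume "f \<in> carrier thompson_F"
  then show "\<exists>g\<in>carrier thompson_F. g \<otimes>\<^bsub>thompson_F\<^esub> f = \<one>\<^bsub>thompson_F\<^esub>"
    unfolding thompson_F_simps using end_multiples_inv end_multiples_inv_comp(1) by blast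
qed (auto simp: thompson_F_simps end_multiples_comp end_multiples_id comp_assoc)

interpretation F: group thompson_F by (rule thompson_F_group)

lemma thompson_F_inv:
  assumes "f \<in> end_multiples 1"
  shows "inv\<^bsub>thompson_F\<^esub> f = inv_into UNIV f"
  by (rule F.inv_equality)
    (use assms end_multiples_inv end_multiples_inv_comp in \<open>auto simp: thompson_F_simps\<close>)

lemma end_multiples_subgroup: "subgroup (end_multiples n) thompson_F"
proof -
  have sub: "end_multiples n \<subseteq> end_multiples 1"
    unfolding end_multiples_def by (auto, metis of_int_mult)
  show ?thesis
  proof (rule subgroup.intro)
    fix f assume "f \<in> end_multiples n"
    then show "inv\<^bsub>thompson_F\<^esub> f \<in> end_multiples n"
      using sub end_multiples_inv thompson_F_inv by auto
  qed (use sub in \<open>auto simp: thompson_F_simps end_multiples_comp end_multiples_id\<close>)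
qed

lemma end_multiples_translation_iff:
  "(\<lambda>t. t + of_int i) \<in> end_multiples n \<longleftrightarrow> n dvd i"
proof
  assume "(\<lambda>t. t + of_int i) \<in> end_multiples n"
  then obtain j where "\<forall>\<^sub>F t in at_top. t + real_of_int i = t + of_int (n * j)"
    unfolding end_multiples_def by blast
  then have "\<exists>t::real. t + real_of_int i = t + of_int (n * j)"
    using eventually_happens trivial_limit_at_top_linorder by blast
  then show "n dvd i" by (metis add_left_cancel dvd_triv_left of_int_eq_iff)
next
  assume "n dvd i"
  then obtain j where "i = n * j" by blast
  then have "\<forall>\<^sub>F t in at_top. t + of_int i = t + real_of_int (n * j)" "\<forall>\<^sub>F t in at_bot. t + of_int i = t + real_of_int i" by auto
  then show "(\<lambda>t. t + of_int i) \<in> end_multiples n" using dyadic_pl_translation unfolding end_multiples_def by blast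
qed

text \<open>The translations by \<open>0\<close> up to \<open>n - 1\<close> represent the cosets.
  They are inequivalent by \<open>end_multiples_translation_iff\<close>, and an element of
  translation length \<open>r\<close> at +infinity belongs to the coset of
  \<open>r mod n\<close>.\<close>

lemma card_rcosets_end_multiples:
  assumes "n > 0"
  shows "card (rcosets\<^bsub>thompson_F\<^esub> (end_multiples n)) = nat n"
proof -
  let ?\<tau> = "\<lambda>(i::int) (t::real). t + of_int i" and ?A = "end_multiples n"
  let ?C = "\<lambda>i. ?A #>\<^bsub>thompson_F\<^esub> ?\<tau> i"
  have \<tau>: "?\<tau> i \<in> carrier thompson_F" for i by (simp add: thompson_F_simps translation_in_end_multiples)
  have mem: "\<exists>g\<in>?A. f = g \<circ> h" if "f \<in> ?A #>\<^bsub>thompson_F\<^esub> h" for f h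
    using that by (auto simp: r_coset_def thompson_F_simps)
  have "inj_on ?C {0..<n}"
  proof (rule inj_onI)
    fix i j assume ij: "i \<in> {0..<n}" "j \<in> {0..<n}" "?C i = ?C j"
    have "?\<tau> i \<in> ?C j" using F.rcos_self[OF \<tau> end_multiples_subgroup] ij(3) by metis
    then obtain g where g: "g \<in> ?A" "?\<tau> i = g \<circ> ?\<tau> j" using mem by blast
    have "g = ?\<tau> (i - j)"
    proof
      fix t show "g t = ?\<tau> (i - j) t" using fun_cong[OF g(2), of "t - of_int j"] by simp
    qed
    then have "n dvd i - j" using g(1) end_multiples_translation_iff by blast
    then have "i mod n = j mod n" by (simp add: mod_eq_dvd_iff)
    then show "i = j" using ij by simp
  qed
  moreover have "?C ` {0..<n} = rcosets\<^bsub>thompson_F\<^esub> ?A"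
  proof (intro equalityI subsetI)
    fix X assume "X \<in> ?C ` {0..<n}"
    then show "X \<in> rcosets\<^bsub>thompson_F\<^esub> ?A" using \<tau> unfolding RCOSETS_def by blast
  next
    fix X assume "X \<in> rcosets\<^bsub>thompson_F\<^esub> ?A"
    then obtain f where f: "f \<in> end_multiples 1" "X = ?A #>\<^bsub>thompson_F\<^esub> f"
      by (auto simp: RCOSETS_def thompson_F_simps)
    obtain r :: int where r: "\<forall>\<^sub>F t in at_top. f t = t + of_int r" using f(1) by (auto simp: end_multiples_def)
    \<comment> \<open>Removing the remainder leaves translation length
      \<open>n * (r div n)\<close>.\<close>
    let ?i = "r mod n" let ?g = "f \<circ> ?\<tau> (- ?i)"
    have g1: "?g \<in> end_multiples 1" using f(1) translation_in_end_multiples end_multiples_comp by blast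
    have "\<forall>\<^sub>F t in at_top. ?g t = t + of_int (n * (r div n))"
      using eventually_translation[OF r disjI1[OF refl], of "- ?i"]
    proof eventually_elim
      case (elim t)
      have "real_of_int r = of_int (n * (r div n)) + of_int ?i"
        by (metis mult_div_mod_eq of_int_add)
      then show ?case using elim by simp
    qed
    then have "?g \<in> ?A" using g1 unfolding end_multiples_def by blast
    moreover have "f = ?g \<circ> ?\<tau> ?i" by (auto simp: fun_eq_iff)
    ultimately have "f \<in> ?C ?i" by (auto simp: r_coset_def thompson_F_simps)
    then have "X = ?C ?i" using F.repr_independence[OF _ \<tau> end_multiples_subgroup] f(2) by metis
    then show "X \<in> ?C ` {0..<n}" using assms by auto
  qed
  ultimately show ?thesis by (metis card_image card_atLeastLessThan_int diff_zero)
qed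

lemma end_multiples_finite_index:
  assumes "n > 0"
  shows "finite_index_subgroup (end_multiples n) thompson_F"
  using card_rcosets_end_multiples[OF assms] assms end_multiples_subgroup
  by (auto simp: finite_index_subgroup_def intro: card_ge_0_finite)

text \<open>Conjugation by such \<open>h\<close> turns translation by \<open>m * j\<close> near
  +infinity into translation by \<open>n * j\<close>. The map \<open>h\<close> may lie outside
  Thompson's group, as it need not be a translation near +infinity.\<close>

definition end_scaling :: "int \<Rightarrow> int \<Rightarrow> (real \<Rightarrow> real) \<Rightarrow> bool" where
  "end_scaling m n h \<longleftrightarrow> dyadic_pl h \<and> (\<forall>\<^sub>F t in at_bot. h t = t) \<and>
     (\<forall>j. \<forall>\<^sub>F t in at_top. h (t + of_int (m * j)) = h t + of_int (n * j))"

text \<open>Substituting preimages under \<open>h\<close> into the equivariance relation and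
  applying the inverse exchanges \<open>m\<close> and \<open>n\<close>. This symmetry supplies the
  inverse of the conjugation.\<close>

lemma end_scaling_inv:
  assumes "end_scaling m n h"
  shows "end_scaling n m (inv_into UNIV h)"
proof -
  let ?k = "inv_into UNIV h"
  have h: "dyadic_pl h" "\<forall>\<^sub>F t in at_bot. h t = t"
    "\<And>j. \<forall>\<^sub>F t in at_top. h (t + of_int (m * j)) = h t + of_int (n * j)"
    using assms by (auto simp: end_scaling_def)
  note k = dyadic_pl_inv[OF h(1)]
  have kh: "?k (h t) = t" and hk: "h (?k t) = t" for t
    using dyadic_pl_strict[OF h(1)] by (auto simp: surj_f_inv_f)
  have "\<forall>\<^sub>F t in at_bot. ?k t = t" using h(2) by eventually_elim (metis kh)
  moreover have "\<forall>\<^sub>F t in at_top. ?k (t + of_int (n * j)) = ?k t + of_int (m * j)" for j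
    using eventually_compose_filterlim[OF h(3)[of j] dyadic_pl_filterlim(4)[OF k k]]
    by eventually_elim (metis kh hk)
  ultimately show ?thesis using k by (simp add: end_scaling_def)
qed

text \<open>Near +infinity the conjugate sends \<open>t\<close> to
  \<open>h (inv_into UNIV h t + m * j) = t + n * j\<close>; near -infinity \<open>h\<close> and its
  inverse are the identity.\<close>

lemma end_scaling_conj:
  assumes "end_scaling m n h" "f \<in> end_multiples m"
  shows "h \<circ> f \<circ> inv_into UNIV h \<in> end_multiples n"
proof -
  let ?k = "inv_into UNIV h"
  have h: "dyadic_pl h" "\<forall>\<^sub>F t in at_bot. h t = t"
    "\<And>j. \<forall>\<^sub>F t in at_top. h (t + of_int (m * j)) = h t + of_int (n * j)"
    using assms by (auto simp: end_scaling_def)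
  note k = dyadic_pl_inv[OF h(1)]
  have hk: "h (?k t) = t" for t
    using dyadic_pl_strict[OF h(1)] by (auto simp: surj_f_inv_f)
  obtain j l where f: "dyadic_pl f" "\<forall>\<^sub>F t in at_top. f t = t + of_int (m * j)"
    "\<forall>\<^sub>F t in at_bot. f t = t + of_int l"
    using assms(2) by (auto simp: end_multiples_def)
  have "\<forall>\<^sub>F t in at_top. h (f t) = h t + of_int (n * j)"
    using f(2) h(3)[of j] by eventually_elim simp
  from eventually_compose_filterlim[OF this dyadic_pl_filterlim(4)[OF k k]]
  have "\<forall>\<^sub>F t in at_top. (h \<circ> f \<circ> ?k) t = t + of_int (n * j)"
    by eventually_elim (simp add: hk)
  moreover have "\<forall>\<^sub>F t in at_bot. (h \<circ> f \<circ> ?k) t = t + of_int l"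
  proof -
    have "\<forall>\<^sub>F t in at_bot. ?k t = t" using end_scaling_inv[OF assms(1)] by (simp add: end_scaling_def)
    moreover have "\<forall>\<^sub>F t in at_bot. h (f t) = f t"
      using eventually_compose_filterlim[OF h(2) dyadic_pl_filterlim(5)[OF f(1,1)]] .
    ultimately show ?thesis using f(3) by eventually_elim simp
  qed
  moreover have "dyadic_pl (h \<circ> f \<circ> ?k)" using h(1) f(1) k dyadic_pl_comp by blast
  ultimately show ?thesis unfolding end_multiples_def by blast
qed

text \<open>Conjugation by \<open>h\<close> is multiplicative, and conjugation by its inverse, which
  scales from \<open>n\<close> to \<open>m\<close>, undoes it.\<close>

lemma end_scaling_commensuration:
  assumes h: "end_scaling m n h" and "m > 0" "n > 0"
  shows "(end_multiples m, end_multiples n, \<lambda>f\<in>end_multiples m. h \<circ> f \<circ> inv_into UNIV h)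
     \<in> commensurations thompson_F"
proof -
  let ?k = "inv_into UNIV h" let ?c = "\<lambda>f. h \<circ> f \<circ> ?k" and ?d = "\<lambda>f. ?k \<circ> f \<circ> h"
  have pl: "dyadic_pl h" using h by (simp add: end_scaling_def)
  have kh: "?k (h t) = t" and hk: "h (?k t) = t" for t
    using dyadic_pl_strict[OF pl] by (auto simp: surj_f_inv_f)
  have "inv_into UNIV ?k = h" using dyadic_pl_strict[OF pl]
    by (simp add: inv_inv_eq bij_def)
  then have d: "?d f \<in> end_multiples m" if "f \<in> end_multiples n" for f
    using end_scaling_conj[OF end_scaling_inv[OF h] that] by simp
  have c: "?c f \<in> end_multiples n" if "f \<in> end_multiples m" for f
    using end_scaling_conj[OF h that] .
  have "bij_betw ?c (end_multiples m) (end_multiples n)"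
    by (rule bij_betw_byWitness[where f' = ?d]) (use c d in \<open>auto simp: kh hk fun_eq_iff\<close>)
  then have "bij_betw (\<lambda>f\<in>end_multiples m. ?c f) (end_multiples m) (end_multiples n)"
    by (subst bij_betw_restrict_eq)
  moreover have "(\<lambda>f\<in>end_multiples m. ?c f) \<in>
     hom (thompson_F\<lparr>carrier := end_multiples m\<rparr>) (thompson_F\<lparr>carrier := end_multiples n\<rparr>)"
    using c by (intro homI) (auto simp: thompson_F_simps end_multiples_comp kh fun_eq_iff)
  ultimately show ?thesis using end_multiples_finite_index assms(2,3)
    by (simp add: commensurations_def iso_def)
qed

text \<open>Of each \<open>m\<close> consecutive unit intervals on the positive half-line, \<open>stretch m\<close> doubles the last,
  so it turns a shift by \<open>m\<close> into a shift by \<open>m + 1\<close>.\<close>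

definition stretch_int :: "int \<Rightarrow> int \<Rightarrow> int" where
  "stretch_int m n = n + max 0 (n div m)"

definition stretch :: "int \<Rightarrow> real \<Rightarrow> real" where
  "stretch m t = of_int (stretch_int m \<lfloor>t\<rfloor>) +
     of_int (stretch_int m (\<lfloor>t\<rfloor> + 1) - stretch_int m \<lfloor>t\<rfloor>) * (t - of_int \<lfloor>t\<rfloor>)"

section \<open>A homeomorphism scaling the end at +infinity\<close>

context
  fixes m :: int
  assumes m: "m > 0"
begin

text \<open>Passing from \<open>n\<close> to \<open>n + 1\<close> raises the quotient by 0 or 1.
  Hence the slopes of \<open>stretch m\<close> are 1 or 2, both powers of 2.\<close>

lemma stretch_int_step: "stretch_int m (n + 1) - stretch_int m n \<in> {1, 2}"
proof -
  have "(n + 1) div m \<le> (n + m) div m" using m by (intro zdiv_mono1) auto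
  then have "(n + 1) div m \<le> n div m + 1" using m by simp
  moreover have "n div m \<le> (n + 1) div m" using m by (intro zdiv_mono1) auto
  ultimately show ?thesis by (auto simp: stretch_int_def)
qed

lemma stretch_int_mono: "i \<le> j \<Longrightarrow> stretch_int m i \<le> stretch_int m j"
  using zdiv_mono1[of i j m] m by (auto simp: stretch_int_def)

lemma stretch_bounds:
  "of_int (stretch_int m \<lfloor>t\<rfloor>) \<le> stretch m t" "stretch m t < of_int (stretch_int m (\<lfloor>t\<rfloor> + 1))"
proof -
  define d where "d = stretch_int m (\<lfloor>t\<rfloor> + 1) - stretch_int m \<lfloor>t\<rfloor>"
  have d: "d \<ge> 1" and e: "stretch_int m (\<lfloor>t\<rfloor> + 1) = stretch_int m \<lfloor>t\<rfloor> + d"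
    using stretch_int_step[of "\<lfloor>t\<rfloor>"] by (auto simp: d_def)
  have s: "stretch m t = of_int (stretch_int m \<lfloor>t\<rfloor>) + of_int d * (t - of_int \<lfloor>t\<rfloor>)"
    by (simp add: stretch_def d_def)
  have "0 \<le> t - of_int \<lfloor>t\<rfloor>" "t - of_int \<lfloor>t\<rfloor> < 1" by linarith+
  moreover have "real_of_int d > 0" using d by simp
  ultimately have "0 \<le> of_int d * (t - of_int \<lfloor>t\<rfloor>)" "of_int d * (t - of_int \<lfloor>t\<rfloor>) < of_int d * 1"
    by (intro mult_nonneg_nonneg mult_strict_left_mono; simp)+
  then show "of_int (stretch_int m \<lfloor>t\<rfloor>) \<le> stretch m t" "stretch m t < of_int (stretch_int m (\<lfloor>t\<rfloor> + 1))"
    using s e by auto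
qed

lemma strict_mono_stretch: "strict_mono (stretch m)"
proof (rule strict_monoI)
  fix t u :: real assume tu: "t < u"
  show "stretch m t < stretch m u"
  proof (cases "\<lfloor>t\<rfloor> = \<lfloor>u\<rfloor>")
    case True
    have "real_of_int (stretch_int m (\<lfloor>u\<rfloor> + 1) - stretch_int m \<lfloor>u\<rfloor>) > 0"
      using stretch_int_step[of "\<lfloor>u\<rfloor>"] by auto
    then show ?thesis using tu True unfolding stretch_def
      by (metis add_strict_left_mono diff_strict_right_mono mult_strict_left_mono)
  next
    case False
    then have "\<lfloor>t\<rfloor> + 1 \<le> \<lfloor>u\<rfloor>" using tu floor_mono[of t u] by linarith
    then have "stretch_int m (\<lfloor>t\<rfloor> + 1) \<le> stretch_int m \<lfloor>u\<rfloor>" by (rule stretch_int_mono)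
    then show ?thesis using stretch_bounds(2)[of t] stretch_bounds(1)[of u] by linarith
  qed
qed

text \<open>The largest integer \<open>n\<close> whose image is at most \<open>y\<close> locates the
  affine piece over \<open>y\<close>, and that piece is inverted explicitly.\<close>

lemma surj_stretch: "surj (stretch m)"
proof -
  have "\<exists>x. stretch m x = y" for y
  proof -
    \<comment> \<open>\<open>stretch_int m\<close> fixes nonpositive integers and never decreases an
      integer, so the range contains a valid \<open>n\<close> and can stop at the floor of
      \<open>y\<close>.\<close>
    let ?S = "{n \<in> {min 0 \<lfloor>y\<rfloor>..\<lfloor>y\<rfloor>}. of_int (stretch_int m n) \<le> y}"
    have "min 0 \<lfloor>y\<rfloor> div m \<le> 0" using m zdiv_mono1[of "min 0 \<lfloor>y\<rfloor>" 0 m] by simp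
    then have "min 0 \<lfloor>y\<rfloor> \<in> ?S" by (auto simp: stretch_int_def) linarith
    then have ne: "?S \<noteq> {}" by blast
    define n where "n = Max ?S"
    have fin: "finite ?S" by (rule finite_subset[of _ "{min 0 \<lfloor>y\<rfloor>..\<lfloor>y\<rfloor>}"]) auto
    then have nS: "n \<in> ?S" unfolding n_def using ne Max_in by blast
    define d where "d = stretch_int m (n + 1) - stretch_int m n"
    have d: "d \<ge> 1" using stretch_int_step[of n] by (auto simp: d_def)
    have up: "y < of_int (stretch_int m (n + 1))"
    proof (rule ccontr)
      assume a: "\<not> y < of_int (stretch_int m (n + 1))"
      have "n + 1 \<le> stretch_int m (n + 1)" by (simp add: stretch_int_def)
      then have "n + 1 \<le> \<lfloor>y\<rfloor>" using a by linarith
      then have "n + 1 \<in> ?S" using nS a by auto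
      then show False using Max_ge[OF fin, of "n + 1"] unfolding n_def by simp
    qed
    define t where "t = of_int n + (y - of_int (stretch_int m n)) / of_int d"
    have "y - of_int (stretch_int m n) < of_int d" using up by (simp add: d_def)
    then have "\<lfloor>t\<rfloor> = n" using nS d by (intro floor_unique) (auto simp: t_def)
    then have "stretch m t = y" using d by (simp add: stretch_def d_def[symmetric] t_def)
    then show "\<exists>x. stretch m x = y" by blast
  qed
  then show ?thesis unfolding surj_def by metis
qed

text \<open>The closed interval serves left germs at integers as well. At its right end point the
  floor jumps, but the adjacent affine expressions agree there.\<close>

lemma stretch_affine:
  "\<exists>k::int. \<exists>b\<in>dyadic_rationals. \<forall>t\<in>{of_int n..of_int n + 1}. stretch m t = 2 powi k * t + b"
proof -
  let ?d = "stretch_int m (n + 1) - stretch_int m n"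
  let ?b = "of_int (stretch_int m n - ?d * n) :: real"
  have "?d = 1 \<or> ?d = 2" using stretch_int_step[of n] by auto
  then obtain k :: int where k: "real_of_int ?d = 2 powi k"
  proof
    assume "?d = 1" then show ?thesis using that[of 0] by simp
  next
    assume "?d = 2" then show ?thesis using that[of 1] by simp
  qed
  have "stretch m t = of_int ?d * t + ?b" if t: "t \<in> {of_int n..of_int n + 1}" for t
  proof (cases "t = of_int n + 1")
    case True
    then have "\<lfloor>t\<rfloor> = n + 1" by linarith
    then show ?thesis using True by (simp add: stretch_def algebra_simps)
  next
    case False
    then have "\<lfloor>t\<rfloor> = n" using t by (intro floor_unique) auto
    then show ?thesis by (simp add: stretch_def algebra_simps)
  qed
  then show ?thesis using k dyadic_of_int by metis
qed

lemma dyadic_pl_stretch: "dyadic_pl (stretch m)"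
proof -
  have germ: "dyadic_affine (stretch m) G" if "\<forall>\<^sub>F t in G. t \<in> {of_int n..of_int n + 1}" for G and n :: int
  proof -
    obtain k b where kb: "b \<in> dyadic_rationals"
      "\<forall>t\<in>{of_int n..of_int n + 1}. stretch m t = 2 powi k * t + b"
      using stretch_affine[of n] by blast
    have "\<forall>\<^sub>F t in G. stretch m t = 2 powi k * t + b"
      using that by eventually_elim (use kb in auto)
    then show ?thesis using kb(1) unfolding dyadic_affine_def by blast
  qed
  have "dyadic_affine (stretch m) (at_right x)" for x
  proof (rule germ[of "\<lfloor>x\<rfloor>"])
    have "x < of_int \<lfloor>x\<rfloor> + 1" by linarith
    then show "\<forall>\<^sub>F t in at_right x. t \<in> {of_int \<lfloor>x\<rfloor>..of_int \<lfloor>x\<rfloor> + 1}"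
      by (rule eventually_at_rightI[rotated]) (auto, linarith)
  qed
  moreover have "dyadic_affine (stretch m) (at_left x)" for x
  proof (rule germ[of "\<lceil>x\<rceil> - 1"])
    \<comment> \<open>The ceiling selects the unit interval to the left of \<open>x\<close> even
      when \<open>x\<close> is an integer.\<close>
    have "of_int (\<lceil>x\<rceil> - 1) < x" by linarith
    then show "\<forall>\<^sub>F t in at_left x. t \<in> {of_int (\<lceil>x\<rceil> - 1)..of_int (\<lceil>x\<rceil> - 1) + 1}"
      by (rule eventually_at_leftI[rotated]) (auto, linarith)
  qed
  moreover have "dyadic_affine (stretch m) (nhds x)" if "x \<notin> dyadic_rationals" for x
  proof (rule germ[of "\<lfloor>x\<rfloor>"])
    \<comment> \<open>Integers are dyadic, so a non-dyadic \<open>x\<close> is interior to a unit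
      interval.\<close>
    have "x \<noteq> of_int \<lfloor>x\<rfloor>" using that dyadic_of_int by metis
    then have "x \<in> {of_int \<lfloor>x\<rfloor><..<of_int \<lfloor>x\<rfloor> + 1}" by (auto; linarith)
    then have "\<forall>\<^sub>F t in nhds x. t \<in> {of_int \<lfloor>x\<rfloor><..<of_int \<lfloor>x\<rfloor> + 1}"
      by (intro eventually_nhds_in_open) auto
    then show "\<forall>\<^sub>F t in nhds x. t \<in> {of_int \<lfloor>x\<rfloor>..of_int \<lfloor>x\<rfloor> + 1}"
      by eventually_elim auto
  qed
  ultimately show ?thesis using strict_mono_stretch surj_stretch by (simp add: dyadic_pl_def)
qed

text \<open>On nonnegative arguments the clipping by \<open>max 0\<close> is inactive; the argument
  gains \<open>m * j\<close> and the quotient gains \<open>j\<close>.\<close>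

lemma stretch_int_add:
  assumes "n \<ge> 0" "n + m * j \<ge> 0"
  shows "stretch_int m (n + m * j) = stretch_int m n + (m + 1) * j"
proof -
  have "(n + m * j) div m = n div m + j" using m by simp
  moreover have "n div m \<ge> 0" "(n + m * j) div m \<ge> 0"
    using assms m by (simp_all only: pos_imp_zdiv_nonneg_iff)
  ultimately show ?thesis by (simp add: stretch_int_def algebra_simps)
qed

text \<open>Near +infinity \<open>stretch_int_add\<close> applies to both end points of the unit
  interval around \<open>t\<close>; near -infinity both are nonpositive and fixed.\<close>

lemma end_scaling_stretch: "end_scaling m (m + 1) (stretch m)"
proof -
  have "stretch m (t + of_int (m * j)) = stretch m t + of_int ((m + 1) * j)"
    if "t \<ge> 0" "t \<ge> - of_int (m * j)" for t j
  proof -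
    have f: "\<lfloor>t + of_int (m * j)\<rfloor> = \<lfloor>t\<rfloor> + m * j" by (rule floor_add_int[symmetric])
    have "\<lfloor>t\<rfloor> \<ge> 0" "\<lfloor>t + of_int (m * j)\<rfloor> \<ge> 0" using that by (auto simp only: zero_le_floor)
    then have "\<lfloor>t\<rfloor> \<ge> 0" "\<lfloor>t\<rfloor> + m * j \<ge> 0" unfolding f by auto
    then have "stretch_int m (\<lfloor>t\<rfloor> + m * j) = stretch_int m \<lfloor>t\<rfloor> + (m + 1) * j"
      "stretch_int m (\<lfloor>t\<rfloor> + m * j + 1) = stretch_int m (\<lfloor>t\<rfloor> + 1) + (m + 1) * j"
      using stretch_int_add[of "\<lfloor>t\<rfloor>" j] stretch_int_add[of "\<lfloor>t\<rfloor> + 1" j] by (simp_all add: ac_simps)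
    then show ?thesis unfolding stretch_def f by simp
  qed
  \<comment> \<open>The bound covers negative \<open>j\<close>, for which the shifted point must
    stay nonnegative too.\<close>
  then have "\<forall>\<^sub>F t in at_top. stretch m (t + of_int (m * j)) = stretch m t + of_int ((m + 1) * j)" for j
    by (intro eventually_at_top_linorderI[of "max 0 (- of_int (m * j))"]) simp
  moreover have "stretch m t = t" if "t \<le> -1" for t
  proof -
    have t: "\<lfloor>t\<rfloor> + 1 \<le> 0" using that by linarith
    have "\<lfloor>t\<rfloor> \<le> 0" using t by linarith
    then have "\<lfloor>t\<rfloor> div m \<le> 0" "(\<lfloor>t\<rfloor> + 1) div m \<le> 0"
      using zdiv_mono1[OF _ m, of _ 0] t by auto
    then have "stretch_int m \<lfloor>t\<rfloor> = \<lfloor>t\<rfloor>" "stretch_int m (\<lfloor>t\<rfloor> + 1) = \<lfloor>t\<rfloor> + 1"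
      by (simp_all add: stretch_int_def)
    then show ?thesis by (simp add: stretch_def)
  qed
  then have "\<forall>\<^sub>F t in at_bot. stretch m t = t" unfolding eventually_at_bot_linorder by blast
  ultimately show ?thesis using dyadic_pl_stretch by (simp add: end_scaling_def)
qed

end

text \<open>Stretching with \<open>m = p - 1\<close> gives index \<open>p - 1\<close> for the domain
  and \<open>p\<close> for the codomain. For \<open>p = 2\<close> the domain is the whole
  group.\<close>

lemma thompson_F_prime_commensuration:
  assumes "prime (p::nat)"
  shows "\<exists>A B \<alpha>. (A, B, \<alpha>) \<in> commensurations thompson_F \<and>
    \<not> p dvd card (rcosets\<^bsub>thompson_F\<^esub> A) \<and> p dvd card (rcosets\<^bsub>thompson_F\<^esub> B)"
proof -
  let ?m = "int p - 1"
  have p: "p \<ge> 2" using assms by (rule prime_ge_2_nat)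
  then have m: "?m > 0" by simp
  have "card (rcosets\<^bsub>thompson_F\<^esub> (end_multiples ?m)) = p - 1"
    using card_rcosets_end_multiples[OF m] by simp
  moreover have "card (rcosets\<^bsub>thompson_F\<^esub> (end_multiples (?m + 1))) = p"
    using card_rcosets_end_multiples[of "?m + 1"] p by simp
  moreover have "\<not> p dvd p - 1" using p by (auto dest: dvd_imp_le)
  ultimately show ?thesis
    using end_scaling_commensuration[OF end_scaling_stretch[OF m] m] m by force
qed

theorem mainTheorem4:
  shows "\<not> finitely_generated_group (commensurator thompson_F)"
  using F.commensurator_not_fg[OF thompson_F_prime_commensuration] .

end
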